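(* Let $\mu \in \mathcal{M}$. Then $\mu$ is infinitely divisible with respect to $\boxplus$ if and only if $\phi(\mu) \ge 1$, where $$\phi(\mu) := \sup\{ t \in [0,\infty) \mid \mu \in \mathbb{B}_t(\mathcal{M}) \} \in [0,\infty]$$ is the $\boxplus$-divisibility indicator of $\mu$.
   Context: $\mathcal{M}$ is the set of Borel probability measures on $\mathbb{R}$; $\mathbb{C}^+$ is the open upper half-plane. For $\mu \in \mathcal{M}$: $G_\mu(z) = \int_{\mathbb{R}} \frac{d\mu(s)}{z-s}$ is the Cauchy transform and $F_\mu(z) = 1/G_\mu(z)$ the reciprocal Cauchy transform; $F_\mu$ is an analytic self-map of $\mathbb{C}^+$. For every $\alpha>0$ there is $\beta>0$ such that $F_\mu$ has an analytic right inverse $F_\mu^{-1}$ on $\Gamma_{\alpha,\beta}=\{z\in\mathbb{C}^+ : |\Re z|<\alpha\,\Im z,\ \Im z>\beta\}$ with $F_\mu^{-1}(z)/z\to 1$ as $z\to\infty$ in $\Gamma_{\alpha,\beta}$; put $V_\mu(z) = F_\mu^{-1}(z)-z$ there. Free additive convolution $\boxplus$ is determined by $V_{\mu\boxplus\nu} = V_\mu+V_\nu$ on a common truncated cone. For $t\ge 1$, $\mu^{\boxplus t}\in\mathcal{M}$ is the unique probability measure with $V_{\mu^{\boxplus t}} = tV_\mu$ on a common truncated cone (it is known to exist). For $t>0$, the Boolean convolution power $\mu^{\uplus t}\in\mathcal{M}$ is the unique probability measure with $F_{\mu^{\uplus t}}(z) = tF_\mu(z)+(1-t)z$, $z\in\mathbb{C}^+$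 (it always exists). For $t\ge0$, $\mathbb{B}_t:\mathcal{M}\to\mathcal{M}$ is $\mathbb{B}_t(\mu) = \bigl( \mu^{\boxplus(1+t)} \bigr)^{\uplus(1/(1+t))}$, and $\mathbb{B}_t(\mathcal{M})$ is its range. A measure $\mu\in\mathcal{M}$ is infinitely divisible with respect to $\boxplus$ if for every $n\ge1$ there is $\mu_n\in\mathcal{M}$ with $\mu_n^{\boxplus n}=\mu$ ($n$-fold $\boxplus$-convolution). *)

theory Defs
  imports "HOL-Probability.Probability" "HOL-Complex_Analysis.Complex_Analysis"
begin

definition borel_prob_measures :: "real measure set" where
  "borel_prob_measures = {\<mu>. real_distribution \<mu>}"

definition upper_half_plane :: "complex set" where
  "upper_half_plane = {z. Im z > 0}"

definition truncated_cone :: "real \<Rightarrow> real \<Rightarrow> complex set" where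
  "truncated_cone \<alpha> \<beta> =
     {z \<in> upper_half_plane. \<bar>Re z\<bar> < \<alpha> * Im z \<and> Im z > \<beta>}"

(* cauchy_transform and F_transform are total functions, but they are only meaningful, and only
   used below, on the upper half-plane. *)
definition cauchy_transform :: "real measure \<Rightarrow> complex \<Rightarrow> complex" where
  "cauchy_transform \<mu> z = (\<integral>s. 1 / (z - complex_of_real s) \<partial>\<mu>)"

definition F_transform :: "real measure \<Rightarrow> complex \<Rightarrow> complex" where
  "F_transform \<mu> z = 1 / cauchy_transform \<mu> z"

definition is_F_right_inverse ::
    "real measure \<Rightarrow> real \<Rightarrow> real \<Rightarrow> (complex \<Rightarrow> complex) \<Rightarrow> bool" where
  "is_F_right_inverse \<mu> \<alpha> \<beta> f \<longleftrightarrow>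
     f holomorphic_on truncated_cone \<alpha> \<beta> \<and>
     f ` truncated_cone \<alpha> \<beta> \<subseteq> upper_half_plane \<and>
     (\<forall>z\<in>truncated_cone \<alpha> \<beta>. F_transform \<mu> (f z) = z) \<and>
     ((\<lambda>z. f z / z) \<longlongrightarrow> 1) (inf at_infinity (principal (truncated_cone \<alpha> \<beta>)))"

(* The transform V is only defined on truncated cones that depend on the measure, so it is
   rendered as a relation. On a given cone its values are unique: the normalisation at infinity
   singles out one right inverse. *)
definition is_V_transform ::
    "real measure \<Rightarrow> real \<Rightarrow> real \<Rightarrow> (complex \<Rightarrow> complex) \<Rightarrow> bool" where
  "is_V_transform \<mu> \<alpha> \<beta> v \<longleftrightarrow>
     (\<exists>f. is_F_right_inverse \<mu> \<alpha> \<beta> f \<and> (\<forall>z\<in>truncated_cone \<alpha> \<beta>. v z = f z - z))"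

definition free_conv :: "real measure \<Rightarrow> real measure \<Rightarrow> real measure" where
  "free_conv \<mu> \<nu> = (THE \<rho>. \<rho> \<in> borel_prob_measures \<and>
     (\<exists>\<alpha>>0. \<exists>\<beta>>0. \<exists>u v w.
        is_V_transform \<mu> \<alpha> \<beta> u \<and> is_V_transform \<nu> \<alpha> \<beta> v \<and> is_V_transform \<rho> \<alpha> \<beta> w \<and>
        (\<forall>z\<in>truncated_cone \<alpha> \<beta>. w z = u z + v z)))"

(* Meaningful for real exponents t \<ge> 1. *)
definition free_power :: "real measure \<Rightarrow> real \<Rightarrow> real measure" where
  "free_power \<mu> t = (THE \<rho>. \<rho> \<in> borel_prob_measures \<and>
     (\<exists>\<alpha>>0. \<exists>\<beta>>0. \<exists>u w.
        is_V_transform \<mu> \<alpha> \<beta> u \<and> is_V_transform \<rho> \<alpha> \<beta> w \<and>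
        (\<forall>z\<in>truncated_cone \<alpha> \<beta>. w z = of_real t * u z)))"

(* Meaningful for t > 0. *)
definition boolean_power :: "real measure \<Rightarrow> real \<Rightarrow> real measure" where
  "boolean_power \<mu> t = (THE \<rho>. \<rho> \<in> borel_prob_measures \<and>
     (\<forall>z\<in>upper_half_plane.
        F_transform \<rho> z = of_real t * F_transform \<mu> z + (1 - of_real t) * z))"

definition BB :: "real \<Rightarrow> real measure \<Rightarrow> real measure" where
  "BB t \<mu> = boolean_power (free_power \<mu> (1 + t)) (1 / (1 + t))"

(* For n \<ge> 1: the free convolution of n copies of the measure. *)
definition free_conv_nfold :: "nat \<Rightarrow> real measure \<Rightarrow> real measure" where
  "free_conv_nfold n \<mu> = (free_conv \<mu> ^^ (n - 1)) \<mu>"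

definition free_infinitely_divisible :: "real measure \<Rightarrow> bool" where
  "free_infinitely_divisible \<mu> \<longleftrightarrow>
     (\<forall>n\<ge>1. \<exists>\<mu>\<^sub>n\<in>borel_prob_measures. free_conv_nfold n \<mu>\<^sub>n = \<mu>)"

definition free_divisibility_indicator :: "real measure \<Rightarrow> ennreal" where
  "free_divisibility_indicator \<mu> =
     Sup {ennreal t | t. 0 \<le> t \<and> \<mu> \<in> BB t ` borel_prob_measures}"

end

theory Submission
  imports Defs
begin

text \<open>
  Put \<open>E\<^sub>\<nu>(w) = w - F\<^sub>\<nu>(w)\<close>. For \<open>t \<ge> 0\<close> and \<open>z\<close> in the upper half-plane, the equation
  \<open>\<omega> + t E\<^sub>\<nu>(\<omega>) = z\<close> has exactly one solution \<open>\<omega> = \<omega>\<^sub>t(z)\<close> there (Schwarz--Pick makes the map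
  \<open>w \<mapsto> w + t E\<^sub>\<nu>(w)\<close> injective, with closed range, over the half-plane). The function
  \<open>F\<^sub>\<nu> \<circ> \<omega>\<^sub>t\<close> is the reciprocal Cauchy transform of the free power \<open>1 + t\<close> of \<open>\<nu>\<close>, and
  \<open>z - E\<^sub>\<nu>(\<omega>\<^sub>t(z))\<close> is that of \<open>BB t \<nu>\<close>. Existence of all these measures comes from the
  Nevanlinna-type theorem that a holomorphic self-map \<open>F\<close> of the half-plane with
  \<open>F(\<i>y) / (\<i>y) \<rightarrow> 1\<close> is the reciprocal Cauchy transform of a probability measure.

  With these formulas, for \<open>t \<ge> m / (1 + m)\<close> the measure \<open>BB t \<nu>\<close> is the free power \<open>1 + m\<close>
  of the Boolean power \<open>1 / (1 + m)\<close> of \<open>BB (t - m / (1 + m)) \<nu>\<close>, and conversely a free power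
  \<open>1 + m\<close> of \<open>\<sigma>\<close> is \<open>BB (m / (1 + m))\<close> of the Boolean power \<open>1 + m\<close> of \<open>\<sigma>\<close>. Since
  \<open>m / (1 + m)\<close> increases to \<open>1\<close> without reaching it, no limit of measures is needed.
\<close>

subsection \<open>The Schwarz--Pick inequality on the upper half-plane\<close>

text \<open>The exponent arithmetic comes from following one value of \<open>E\<close> along the
  line \<open>w + t * E\<close>. Passing to \<open>BB t\<close> moves the base point from
  \<open>w\<close> to \<open>w + t * E w\<close> and leaves the value of \<open>E\<close> unchanged.
  A Boolean power \<open>c\<close> keeps the point and multiplies the value by \<open>c\<close>. A
  free power \<open>1 + m\<close> moves the point by \<open>m * E w\<close> and multiplies the value
  by \<open>1 + m\<close>. So a free power \<open>1 + m\<close> combined with a Boolean rescaling,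
  by \<open>1 / (1 + m)\<close> before it or by \<open>1 + m\<close> compensated inside
  \<open>BB\<close>, advances the time by exactly \<open>m / (1 + m)\<close>. Two obstacles shape
  the development. Every operation on measures is a definite description, so a formula can be used
  only once existence and uniqueness of the measure are proved; this is what the Nevanlinna-type
  theorem and the injectivity of the Cauchy transform are for. And \<open>V\<close> lives only on
  truncated cones, whereas Boolean powers refer to the whole half-plane; the globally solved
  equation for \<omega> carries information from the cone to the half-plane.\<close>

lemma cmod_diff_cnj_sq: "(cmod (a - cnj b))\<^sup>2 = (cmod (a - b))\<^sup>2 + 4 * (Im a * Im b)"
  by (simp only: cmod_power2) (simp add: power2_eq_square algebra_simps)

lemma open_upper_half_plane: "open upper_half_plane"
  unfolding upper_half_plane_def by (rule open_halfspace_Im_gt)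

lemma convex_upper_half_plane: "convex upper_half_plane"
  unfolding upper_half_plane_def by (rule convex_halfspace_Im_gt)

lemma connected_upper_half_plane: "connected upper_half_plane"
  by (rule convex_connected[OF convex_upper_half_plane])

lemma mem_upper_half_plane [simp]: "z \<in> upper_half_plane \<longleftrightarrow> 0 < Im z"
  by (simp add: upper_half_plane_def)

text \<open>Cayley transforms carry \<open>w\<close> and \<open>f w\<close> to the centre of the
  disc, where the Schwarz lemma applies. The resulting comparison of pseudo-hyperbolic distances is
  rewritten by \<open>cmod_diff_cnj_sq\<close> into products, a form that survives the limit to
  vanishing imaginary parts.\<close>

lemma schwarz_pick_open:
  assumes holf: "f holomorphic_on upper_half_plane"
    and pos: "\<And>z. 0 < Im z \<Longrightarrow> 0 < Im (f z)"
    and z: "0 < Im z" and w: "0 < Im w"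
  shows "(cmod (f z - f w))\<^sup>2 * (Im z * Im w) \<le> (cmod (z - w))\<^sup>2 * (Im (f z) * Im (f w))"
proof -
  \<comment> \<open>Inverse Cayley transform: it maps the disc to the half-plane and 0 to
    \<open>w\<close>.\<close>
  define \<phi> where "\<phi> \<zeta> = (w - cnj w * \<zeta>) / (1 - \<zeta>)" for \<zeta>
  define g where "g \<zeta> = (f (\<phi> \<zeta>) - f w) / (f (\<phi> \<zeta>) - cnj (f w))" for \<zeta>
  have ne1: "1 - \<zeta> \<noteq> 0" if "cmod \<zeta> < 1" for \<zeta>
    using that by auto
  have Im\<phi>: "0 < Im (\<phi> \<zeta>)" if \<zeta>: "cmod \<zeta> < 1" for \<zeta>
  proof -
    have "\<phi> \<zeta> = (w - cnj w * \<zeta>) * cnj (1 - \<zeta>) / (1 - \<zeta>) / cnj (1 - \<zeta>)"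
      using ne1[OF \<zeta>] by (simp add: \<phi>_def)
    also have "\<dots> = (w - cnj w * \<zeta>) * cnj (1 - \<zeta>) / of_real ((cmod (1 - \<zeta>))\<^sup>2)"
      by (simp only: complex_norm_square divide_divide_eq_left)
    finally have "Im (\<phi> \<zeta>) = Im ((w - cnj w * \<zeta>) * cnj (1 - \<zeta>)) / (cmod (1 - \<zeta>))\<^sup>2"
      by (simp only: Im_divide_of_real)
    also have "Im ((w - cnj w * \<zeta>) * cnj (1 - \<zeta>)) = Im w * (1 - (cmod \<zeta>)\<^sup>2)"
      by (simp only: cmod_power2) (simp add: power2_eq_square algebra_simps)
    also have "\<dots> / (cmod (1 - \<zeta>))\<^sup>2 > 0"
      using ne1[OF \<zeta>] w \<zeta> by (auto intro!: divide_pos_pos mult_pos_pos simp: power_less_one_iff abs_square_less_1)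
    finally show ?thesis .
  qed
  have ne_cnj: "a \<noteq> cnj b" if "0 < Im a" "0 < Im b" for a b
    using that by (auto simp: complex_eq_iff)
  have ball: "ball 0 1 = {\<zeta>::complex. cmod \<zeta> < 1}"
    by auto
  have "\<phi> holomorphic_on ball 0 1"
    unfolding \<phi>_def ball using ne1 by (auto intro!: holomorphic_intros)
  then have "(f \<circ> \<phi>) holomorphic_on ball 0 1"
    by (rule holomorphic_on_compose_gen[OF _ holf]) (auto simp: Im\<phi>)
  then have holg: "g holomorphic_on ball 0 1"
    unfolding g_def using ne_cnj[OF pos[OF Im\<phi>] pos[OF w]]
    by (auto intro!: holomorphic_intros simp: o_def)
  have g0: "g 0 = 0"
    by (simp add: g_def \<phi>_def)
  have less: "cmod (a - b) < cmod (a - cnj b)" if "0 < Im a" "0 < Im b" for a b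
    using cmod_diff_cnj_sq[of a b] that
    by (smt (verit) mult_pos_pos norm_ge_zero power_mono)
  have g1: "cmod (g \<zeta>) < 1" if "cmod \<zeta> < 1" for \<zeta>
    using less[OF pos[OF Im\<phi>[OF that]] pos[OF w]] 
    unfolding g_def norm_divide by (subst divide_less_eq_1_pos) auto
  define \<zeta> where "\<zeta> = (z - w) / (z - cnj w)"
  have \<zeta>1: "cmod \<zeta> < 1"
    using less[OF z w] unfolding \<zeta>_def norm_divide by (subst divide_less_eq_1_pos) auto
  have zw: "z - cnj w \<noteq> 0" and ww: "w - cnj w \<noteq> 0"
    using ne_cnj[of z w] ne_cnj[of w w] z w by auto
  have "1 - \<zeta> = (w - cnj w) / (z - cnj w)" 
    using zw by (simp add: \<zeta>_def field_simps)
  moreover have "w - cnj w * \<zeta> = z * (w - cnj w) / (z - cnj w)"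
    using zw by (simp add: \<zeta>_def field_simps)
  ultimately have "\<phi> \<zeta> = z"
    unfolding \<phi>_def using zw ww by simp
  then have "cmod (f z - f w) / cmod (f z - cnj (f w)) \<le> cmod (z - w) / cmod (z - cnj w)"
    using Schwarz_Lemma(1)[OF holg g0 g1 \<zeta>1] by (simp add: g_def \<zeta>_def norm_divide)
  then have "(cmod (f z - f w) / cmod (f z - cnj (f w)))\<^sup>2 \<le> (cmod (z - w) / cmod (z - cnj w))\<^sup>2"
    by (intro power_mono) auto
  then have *: "(cmod (f z - f w))\<^sup>2 / ((cmod (f z - f w))\<^sup>2 + 4 * (Im (f z) * Im (f w)))
    \<le> (cmod (z - w))\<^sup>2 / ((cmod (z - w))\<^sup>2 + 4 * (Im z * Im w))"
    unfolding power_divide cmod_diff_cnj_sq .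
  have p: "0 < Im z * Im w" "0 < Im (f z) * Im (f w)" 
    using z w pos by auto
  have cross: "A * q \<le> B * p" 
    if "A / (A + 4 * p) \<le> B / (B + 4 * q)" "0 < p" "0 < q" "0 \<le> A" "0 \<le> B" for A B p q :: real
  proof -
    have "A * (B + 4 * q) \<le> B * (A + 4 * p)"
      using that by (simp add: divide_simps split: if_splits)
    then show ?thesis by (simp add: algebra_simps)
  qed
  show ?thesis
    by (rule cross[OF *]) (use p in auto)
qed

text \<open>Adding \<open>\<i> * e\<close> makes the imaginary part positive; then \<open>e\<close>
  tends to 0. The closed version is the one applied to differences such as \<open>F w - w\<close>,
  whose imaginary part may vanish.\<close>

lemma schwarz_pick:
  assumes holf: "f holomorphic_on upper_half_plane"
    and nonneg: "\<And>z. 0 < Im z \<Longrightarrow> 0 \<le> Im (f z)"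
    and z: "0 < Im z" and w: "0 < Im w"
  shows "(cmod (f z - f w))\<^sup>2 * (Im z * Im w) \<le> (cmod (z - w))\<^sup>2 * (Im (f z) * Im (f w))"
proof -
  have "\<forall>\<^sub>F e in at_right 0. (cmod (f z - f w))\<^sup>2 * (Im z * Im w)
      \<le> (cmod (z - w))\<^sup>2 * ((Im (f z) + e) * (Im (f w) + e))"
    unfolding eventually_at_filter
  proof (intro always_eventually allI impI)
    fix e :: real assume "e \<in> {0<..}"
    then show "(cmod (f z - f w))\<^sup>2 * (Im z * Im w)
      \<le> (cmod (z - w))\<^sup>2 * ((Im (f z) + e) * (Im (f w) + e))"
      using schwarz_pick_open[of "\<lambda>z. f z + \<i> * of_real e" z w, OF _ _ z w] holf
      by (simp add: holomorphic_intros add_nonneg_pos nonneg)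
  qed
  moreover have "((\<lambda>e. (cmod (z - w))\<^sup>2 * ((Im (f z) + e) * (Im (f w) + e))) \<longlongrightarrow>
      (cmod (z - w))\<^sup>2 * ((Im (f z) + 0) * (Im (f w) + 0))) (at_right 0)"
    by (intro tendsto_intros)
  ultimately show ?thesis
    by (intro tendsto_lowerbound[where F="at_right (0::real)"]) auto
qed

subsection \<open>Cauchy transforms\<close>

lemma Im_le_cmod_minus_real: "0 < Im z \<Longrightarrow> Im z \<le> cmod (z - of_real s)"
  using abs_Im_le_cmod[of "z - of_real s"] by simp

lemma minus_real_nonzero: "0 < Im z \<Longrightarrow> z - of_real s \<noteq> 0"
  by (auto simp: complex_eq_iff)

lemma cmod_resolvent_le: "0 < Im z \<Longrightarrow> cmod (1 / (z - of_real s)) \<le> 1 / Im z"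
  using Im_le_cmod_minus_real[of z s] by (simp add: norm_divide divide_simps)

lemma (in real_distribution) integrable_resolvent_power:
  assumes "0 < Im z"
  shows "integrable M (\<lambda>s. (1 / (z - complex_of_real s)) ^ n)"
proof (rule integrable_const_bound[where B = "(1 / Im z) ^ n"])
  show "AE s in M. norm ((1 / (z - complex_of_real s)) ^ n) \<le> (1 / Im z) ^ n"
    unfolding norm_power
    by (intro always_eventually allI power_mono cmod_resolvent_le assms) simp
  have "(\<lambda>s. (1 / (z - complex_of_real s)) ^ n) \<in> borel_measurable borel"
    by (intro borel_measurable_power borel_measurable_continuous_onI continuous_intros)
       (use minus_real_nonzero assms in auto)
  then show "(\<lambda>s. (1 / (z - complex_of_real s)) ^ n) \<in> borel_measurable M"
    by simp
qed

lemma (in real_distribution) integrable_resolvent: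
  "0 < Im z \<Longrightarrow> integrable M (\<lambda>s. 1 / (z - complex_of_real s))"
  using integrable_resolvent_power[of z 1] by simp

text \<open>All powers are treated at once because the injectivity proof runs through every
  derivative of the Cauchy transform. Differentiation under the integral is dominated convergence
  along an arbitrary null sequence of increments.\<close>

lemma (in real_distribution) has_derivative_integral_resolvent_power:
  assumes z: "0 < Im z"
  shows "((\<lambda>z. \<integral>s. (1 / (z - complex_of_real s)) ^ n \<partial>M) has_field_derivative
      - of_nat n * (\<integral>s. (1 / (z - complex_of_real s)) ^ Suc n \<partial>M)) (at z)"
  unfolding DERIV_def tendsto_at_iff_sequentially
proof (intro allI impI)
  let ?r = "\<lambda>z s. 1 / (z - complex_of_real s)"
  fix X :: "nat \<Rightarrow> complex"
  assume X0: "\<forall>i. X i \<in> UNIV - {0}" and X: "X \<longlonglongrightarrow> 0"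
  \<comment> \<open>From index \<open>N\<close> on, \<open>z + X i\<close> stays above height
    \<open>Im z / 2\<close>, so one constant \<open>C = 2 / Im z\<close> dominates all
    resolvents.\<close>
  obtain N where N: "\<And>i. i \<ge> N \<Longrightarrow> cmod (X i) < Im z / 2"
    using LIMSEQ_D[OF X, of "Im z / 2"] z by auto
  define Y where "Y i = X (i + N)" for i
  have Y: "Y \<longlonglongrightarrow> 0" "\<And>i. Y i \<noteq> 0" "\<And>i. cmod (Y i) < Im z / 2"
    using X0 N LIMSEQ_ignore_initial_segment[OF X, of N] by (auto simp: Y_def[abs_def])
  have ImY: "Im z / 2 < Im (z + Y i)" for i
    using Y(3)[of i] abs_Im_le_cmod[of "Y i"] by simp
  then have ImY0: "0 < Im (z + Y i)" for i
    using z by (smt (verit) field_sum_of_halves)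
  define C where "C = 2 / Im z"
  have C: "0 < C" using z by (simp add: C_def)
  have bz: "cmod (?r z s) \<le> C" for s
    using cmod_resolvent_le[OF z, of s] z by (simp add: C_def divide_simps) 
  have bY: "cmod (?r (z + Y i) s) \<le> C" for i s
  proof -
    have "1 / Im (z + Y i) \<le> 1 / (Im z / 2)"
      using ImY[of i] z by (intro divide_left_mono) (auto intro: mult_pos_pos)
    then show ?thesis
      using cmod_resolvent_le[OF ImY0, of i s] by (simp add: C_def)
  qed
  \<comment> \<open>Resolvent identity combined with the factorisation of a difference of
    \<open>n\<close>-th powers; the increment \<open>Y i\<close> cancels.\<close>
  have quot: "(?r (z + Y i) s ^ n - ?r z s ^ n) / Y i =
      - (?r (z + Y i) s * ?r z s) * (\<Sum>j<n. ?r z s ^ (n - Suc j) * ?r (z + Y i) s ^ j)" for i s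
  proof -
    have "?r (z + Y i) s - ?r z s = - Y i * (?r (z + Y i) s * ?r z s)"
      using minus_real_nonzero[OF ImY0, of i s] minus_real_nonzero[OF z, of s]
      by (simp add: field_simps)
    then show ?thesis
      using Y(2)[of i] by (simp add: power_diff_sumr2)
  qed
  have const_sum: "- (A * A) * (\<Sum>j<n. A ^ (n - 1)) = - of_nat n * A ^ Suc n" for A :: complex
    by (cases n) (simp_all add: algebra_simps)
  have lim: "(\<lambda>i. (\<integral>s. (?r (z + Y i) s ^ n - ?r z s ^ n) / Y i \<partial>M)) \<longlonglongrightarrow>
      (\<integral>s. - of_nat n * ?r z s ^ Suc n \<partial>M)"
  proof (rule integral_dominated_convergence)
    show "(\<lambda>s. - of_nat n * ?r z s ^ Suc n) \<in> borel_measurable M"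
      using integrable_resolvent_power[OF z, of "Suc n"]
      by (intro borel_measurable_times borel_measurable_const borel_measurable_integrable)
    show "(\<lambda>s. (?r (z + Y i) s ^ n - ?r z s ^ n) / Y i) \<in> borel_measurable M" for i
      using integrable_resolvent_power[OF z, of n] integrable_resolvent_power[OF ImY0, of i n]
      by (intro borel_measurable_divide borel_measurable_diff borel_measurable_const
          borel_measurable_integrable)
    show "integrable M (\<lambda>s. C * C * (\<Sum>j<n. C ^ (n - Suc j) * C ^ j))"
      by simp
    show "AE s in M. (\<lambda>i. (?r (z + Y i) s ^ n - ?r z s ^ n) / Y i) \<longlonglongrightarrow>
        - of_nat n * ?r z s ^ Suc n"
    proof (intro always_eventually allI)
      fix s
      have "(\<lambda>i. ?r (z + Y i) s) \<longlonglongrightarrow> ?r (z + 0) s"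
        using minus_real_nonzero[OF z, of s] by (intro tendsto_intros Y) auto
      then have "(\<lambda>i. (?r (z + Y i) s ^ n - ?r z s ^ n) / Y i) \<longlonglongrightarrow>
        - (?r (z + 0) s * ?r z s) * (\<Sum>j<n. ?r z s ^ (n - Suc j) * ?r (z + 0) s ^ j)"
        unfolding quot using minus_real_nonzero[OF z, of s] by (intro tendsto_intros Y(1)) auto
      also have "(\<Sum>j<n. ?r z s ^ (n - Suc j) * ?r (z + 0) s ^ j) = (\<Sum>j<n. ?r z s ^ (n - 1))"
        by (intro sum.cong refl) (simp only: add_0_right flip: power_add, simp)
      also have "- (?r (z + 0) s * ?r z s) * \<dots> = - of_nat n * ?r z s ^ Suc n"
        by (simp only: add_0_right const_sum)
      finally show "(\<lambda>i. (?r (z + Y i) s ^ n - ?r z s ^ n) / Y i) \<longlonglongrightarrow>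
        - of_nat n * ?r z s ^ Suc n" .
    qed
    show "AE s in M. norm ((?r (z + Y i) s ^ n - ?r z s ^ n) / Y i)
        \<le> C * C * (\<Sum>j<n. C ^ (n - Suc j) * C ^ j)" for i
      unfolding quot norm_mult norm_minus_cancel
      using C bz bY 
      by (intro always_eventually allI mult_mono sum_norm_le)
         (auto simp: norm_mult norm_power intro!: mult_mono power_mono sum_nonneg)
  qed
  have "(\<lambda>i. (\<integral>s. (?r (z + Y i) s ^ n - ?r z s ^ n) / Y i \<partial>M)) =
      (\<lambda>i. ((\<integral>s. ?r (z + Y i) s ^ n \<partial>M) - (\<integral>s. ?r z s ^ n \<partial>M)) / Y i)"
    using integrable_resolvent_power[OF z, of n] integrable_resolvent_power[OF ImY0, of _ n]
    by (simp add: fun_eq_iff)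
  moreover have "(\<integral>s. - of_nat n * ?r z s ^ Suc n \<partial>M) = - of_nat n * (\<integral>s. ?r z s ^ Suc n \<partial>M)"
    by (rule integral_mult_right_zero)
  ultimately have "(\<lambda>i. ((\<lambda>h. ((\<integral>s. ?r (z + h) s ^ n \<partial>M) - (\<integral>s. ?r z s ^ n \<partial>M)) / h) \<circ> X) (i + N))
      \<longlonglongrightarrow> - of_nat n * (\<integral>s. ?r z s ^ Suc n \<partial>M)"
    using lim by (simp only: Y_def o_def)
  then show "((\<lambda>h. ((\<integral>s. ?r (z + h) s ^ n \<partial>M) - (\<integral>s. ?r z s ^ n \<partial>M)) / h) \<circ> X)
      \<longlonglongrightarrow> - of_nat n * (\<integral>s. ?r z s ^ Suc n \<partial>M)"
    by (rule LIMSEQ_offset)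
qed

lemma (in real_distribution) holomorphic_cauchy_transform:
  "cauchy_transform M holomorphic_on upper_half_plane"
  using has_derivative_integral_resolvent_power[of _ 1]
  by (subst holomorphic_on_open[OF open_upper_half_plane])
     (fastforce simp: cauchy_transform_def[abs_def])

lemma Im_resolvent: "Im (1 / (z - complex_of_real s)) = - (Im z / ((Re z - s)\<^sup>2 + (Im z)\<^sup>2))"
  by (simp add: Im_divide)

lemma (in real_distribution) Im_cauchy_transform:
  assumes z: "0 < Im z"
  shows "Im (cauchy_transform M z) = - (\<integral>s. Im z / ((Re z - s)\<^sup>2 + (Im z)\<^sup>2) \<partial>M)"
    and "integrable M (\<lambda>s. Im z / ((Re z - s)\<^sup>2 + (Im z)\<^sup>2))"
proof -
  have "integrable M (\<lambda>s. Im (1 / (z - complex_of_real s)))"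
    using integrable_resolvent[OF z] by (rule integrable_Im)
  then show "integrable M (\<lambda>s. Im z / ((Re z - s)\<^sup>2 + (Im z)\<^sup>2))"
    unfolding Im_resolvent by simp
  show "Im (cauchy_transform M z) = - (\<integral>s. Im z / ((Re z - s)\<^sup>2 + (Im z)\<^sup>2) \<partial>M)"
    unfolding cauchy_transform_def
    using integral_Im[OF integrable_resolvent[OF z]] unfolding Im_resolvent by simp
qed

lemma (in real_distribution) Im_cauchy_transform_neg:
  assumes z: "0 < Im z"
  shows "Im (cauchy_transform M z) < 0"
proof -
  have pos: "0 < Im z / ((Re z - s)\<^sup>2 + (Im z)\<^sup>2)" for s
    using z by (intro divide_pos_pos add_nonneg_pos) auto
  have "(\<integral>s. Im z / ((Re z - s)\<^sup>2 + (Im z)\<^sup>2) \<partial>M) \<noteq> 0"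
  proof
    assume "(\<integral>s. Im z / ((Re z - s)\<^sup>2 + (Im z)\<^sup>2) \<partial>M) = 0"
    then have "AE s in M. Im z / ((Re z - s)\<^sup>2 + (Im z)\<^sup>2) = 0"
      using integral_nonneg_eq_0_iff_AE[OF Im_cauchy_transform(2)[OF z]] pos
      by (auto simp: less_imp_le)
    then have "AE s in M. False"
      using pos by (auto simp: less_le)
    then show False by simp
  qed
  moreover have "0 \<le> (\<integral>s. Im z / ((Re z - s)\<^sup>2 + (Im z)\<^sup>2) \<partial>M)"
    using pos by (intro Bochner_Integration.integral_nonneg) (simp add: less_imp_le)
  ultimately show ?thesis
    unfolding Im_cauchy_transform(1)[OF z] by simp
qed

text \<open>Uniformity over the cone is obtained by contradiction: counterexamples form a sequence
  tending to infinity, and the cone condition bounds \<open>z / (z - s)\<close> by the constant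
  \<open>c\<close>, which makes dominated convergence applicable.\<close>

lemma (in real_distribution) cauchy_transform_nontangential:
  assumes e: "0 < e"
  shows "\<exists>R>0. \<forall>z. R \<le> Im z \<longrightarrow> cmod z \<le> c * Im z \<longrightarrow> cmod (z * cauchy_transform M z - 1) < e"
proof (rule ccontr)
  assume "\<not> ?thesis"
  then have "\<forall>n::nat. \<exists>z. real (Suc n) \<le> Im z \<and> cmod z \<le> c * Im z \<and> 
      e \<le> cmod (z * cauchy_transform M z - 1)"
    by (smt (verit) of_nat_0_less_iff zero_less_Suc)
  then obtain Z where Z: "\<And>n. real (Suc n) \<le> Im (Z n)" "\<And>n. cmod (Z n) \<le> c * Im (Z n)"
      "\<And>n. e \<le> cmod (Z n * cauchy_transform M (Z n) - 1)"
    by metis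
  have Im0: "0 < Im (Z n)" for n
    using Z(1)[of n] by linarith
  have "filterlim (\<lambda>n. real (Suc n)) at_top sequentially"
    by real_asymp
  then have "filterlim (\<lambda>n. cmod (Z n)) at_top sequentially"
    by (rule filterlim_at_top_mono)
       (use Z(1) abs_Im_le_cmod in \<open>auto intro!: always_eventually intro: order_trans simp: abs_le_iff\<close>)
  then have Zinf: "filterlim Z at_infinity sequentially"
    by (rule filterlim_norm_at_top_imp_at_infinity)
  have "(\<lambda>n. \<integral>s. Z n * (1 / (Z n - complex_of_real s)) \<partial>M) \<longlonglongrightarrow> (\<integral>s. 1 \<partial>M)"
  proof (rule integral_dominated_convergence)
    show "(\<lambda>s. Z n * (1 / (Z n - complex_of_real s))) \<in> borel_measurable M" for n
      using integrable_resolvent[OF Im0[of n]]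
      by (intro borel_measurable_times borel_measurable_const borel_measurable_integrable)
    show "integrable M (\<lambda>s. c)" by simp
    show "AE s in M. norm (Z n * (1 / (Z n - complex_of_real s))) \<le> c" for n
    proof (intro always_eventually allI)
      fix s
      have "cmod (Z n) * cmod (1 / (Z n - complex_of_real s)) \<le> (c * Im (Z n)) * (1 / Im (Z n))"
        using Z(2)[of n] cmod_resolvent_le[OF Im0[of n], of s] 
        by (intro mult_mono) (auto intro: order_trans[OF norm_ge_zero])
      then show "norm (Z n * (1 / (Z n - complex_of_real s))) \<le> c"
        using Im0[of n] by (simp add: norm_mult norm_divide)
    qed
    show "AE s in M. (\<lambda>n. Z n * (1 / (Z n - complex_of_real s))) \<longlonglongrightarrow> 1"
    proof (intro always_eventually allI)
      fix s
      have "(\<lambda>n. 1 / (1 - of_real s / Z n)) \<longlonglongrightarrow> 1 / (1 - 0)"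
        by (intro tendsto_intros tendsto_divide_0[OF tendsto_const Zinf]) auto
      moreover have "1 / (1 - of_real s / Z n) = Z n * (1 / (Z n - complex_of_real s))" for n
      proof -
        have "Z n \<noteq> 0" using Im0[of n] by auto
        then show ?thesis by (simp add: field_simps)
      qed
      ultimately show "(\<lambda>n. Z n * (1 / (Z n - complex_of_real s))) \<longlonglongrightarrow> 1" by simp
    qed
  qed simp
  then have "(\<lambda>n. Z n * cauchy_transform M (Z n)) \<longlonglongrightarrow> 1"
    by (simp only: cauchy_transform_def integral_mult_right_zero) (simp add: prob_space del: space_eq_univ)
  then have "(\<lambda>n. cmod (Z n * cauchy_transform M (Z n) - 1)) \<longlonglongrightarrow> cmod (1 - 1)"
    by (intro tendsto_intros)
  then have "e \<le> cmod (1 - 1)"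
    by (rule LIMSEQ_le_const) (use Z(3) in blast)
  then show False using e by simp
qed

section \<open>Injectivity of the Cauchy transform\<close>

text \<open>For numbers of modulus at most 1 the \<open>n\<close>-th powers differ by at most
  \<open>n * cmod (a - b)\<close>. It therefore suffices that \<open>a n\<close> and
  \<open>b n = exp (\<i> * x / n)\<close> agree to first order in \<open>1 / n\<close>.\<close>

lemma tendsto_resolvent_power_iexp:
  "(\<lambda>n. (1 / (1 - \<i> * of_real x / of_nat n)) ^ n) \<longlonglongrightarrow> iexp x"
proof (cases "x = 0")
  case False
  define a where "a n = 1 / (1 - \<i> * of_real x / of_nat n)" for n :: nat
  define b where "b n = exp (\<i> * of_real x / of_nat n)" for n :: nat
  have inf: "filterlim (\<lambda>n. of_nat n :: complex) at_infinity sequentially"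
    by (rule tendsto_of_nat)
  have h0: "(\<lambda>n. \<i> * of_real x / of_nat n) \<longlonglongrightarrow> 0"
    by (rule tendsto_divide_0[OF tendsto_const inf])
  have "filterlim (\<lambda>n. \<i> * complex_of_real x / of_nat n) (at 0) sequentially"
    unfolding filterlim_at using h0 False
    by (auto intro: eventually_mono[OF eventually_gt_at_top[of 0]])
  then have "(\<lambda>n. \<i> * of_real x * ((exp (\<i> * of_real x / of_nat n) - 1) / (\<i> * of_real x / of_nat n)))
      \<longlonglongrightarrow> \<i> * of_real x * 1"
    by (intro tendsto_mult tendsto_const filterlim_compose[OF lim_exp_minus_1])
  then have b: "(\<lambda>n. of_nat n * (b n - 1)) \<longlonglongrightarrow> \<i> * of_real x"
    unfolding mult_1_right
    by (rule Lim_transform_eventually)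
      (use False in \<open>auto simp: b_def intro!: eventually_mono[OF eventually_gt_at_top[of 0]]\<close>)
  have "(\<lambda>n. \<i> * of_real x * (1 / (1 - \<i> * of_real x / of_nat n))) \<longlonglongrightarrow> \<i> * of_real x * (1 / (1 - 0))"
    by (intro tendsto_intros h0) auto
  moreover have "\<forall>\<^sub>F n in sequentially.
      \<i> * of_real x * (1 / (1 - \<i> * of_real x / of_nat n)) = of_nat n * (a n - 1)"
    using eventually_gt_at_top[of 0]
  proof eventually_elim
    case (elim n)
    have "1 - \<i> * of_real x / of_nat n \<noteq> 0" by (auto simp: complex_eq_iff)
    then show ?case using elim by (simp add: a_def field_simps)
  qed
  ultimately have a: "(\<lambda>n. of_nat n * (a n - 1)) \<longlonglongrightarrow> \<i> * of_real x"
    using Lim_transform_eventually by fastforce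
  have "(\<lambda>n. norm (of_nat n * (a n - 1) - of_nat n * (b n - 1))) \<longlonglongrightarrow> norm (\<i> * of_real x - \<i> * of_real x)"
    by (intro tendsto_intros a b)
  then have *: "(\<lambda>n. n * cmod (a n - b n)) \<longlonglongrightarrow> 0"
    by (simp add: norm_mult flip: right_diff_distrib)
  have a1: "cmod (a n) \<le> 1" for n
  proof -
    have "1 \<le> cmod (1 - \<i> * of_real x / of_nat n)"
      using abs_Re_le_cmod[of "1 - \<i> * of_real x / of_nat n"] by simp
    then show ?thesis by (simp only: a_def norm_divide norm_one divide_le_eq_1_pos[OF less_le_trans[OF zero_less_one]])
  qed
  have b1: "cmod (b n) \<le> 1" for n
    by (simp add: b_def)
  have "(\<lambda>n. a n ^ n - b n ^ n) \<longlonglongrightarrow> 0"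
    by (rule Lim_null_comparison[OF _ *]) (use norm_power_diff[OF a1 b1] in simp)
  then have "(\<lambda>n. a n ^ n - iexp x) \<longlonglongrightarrow> 0"
  proof (rule Lim_transform_eventually)
    show "\<forall>\<^sub>F n in sequentially. a n ^ n - b n ^ n = a n ^ n - iexp x"
      using eventually_gt_at_top[of 0]
      by eventually_elim (simp add: b_def flip: exp_of_nat_mult)
  qed
  then show ?thesis
    unfolding a_def by (rule LIM_zero_cancel)
qed simp

text \<open>Post's inversion: derivatives of the Cauchy transform at \<open>n / (\<i>t)\<close> approximate the
  characteristic function at \<open>t\<close>.\<close>

lemma cauchy_transform_inject:
  assumes "real_distribution \<mu>" "real_distribution \<nu>"
    and eq: "\<And>z. 0 < Im z \<Longrightarrow> cauchy_transform \<mu> z = cauchy_transform \<nu> z"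
  shows "\<mu> = \<nu>"
proof -
  interpret \<mu>: real_distribution \<mu> by fact
  interpret \<nu>: real_distribution \<nu> by fact
  let ?r = "\<lambda>z s. 1 / (z - complex_of_real s)"
  have powers: "(\<integral>s. ?r z s ^ n \<partial>\<mu>) = (\<integral>s. ?r z s ^ n \<partial>\<nu>)" if "0 < Im z" for z n
    using that
  proof (induction n arbitrary: z)
    case 0
    then show ?case
      by (simp add: \<mu>.prob_space \<nu>.prob_space del: \<mu>.space_eq_univ \<nu>.space_eq_univ)
  next
    case (Suc n)
    \<comment> \<open>Differentiating the power \<open>n\<close> produces the factor
      \<open>n\<close>, so the step from power 0 to power 1 has to come from the hypothesis on
      Cauchy transforms instead.\<close>
    show ?case
    proof (cases "n = 0")
      case True
      then show ?thesis
        using eq[OF Suc.prems] by (simp add: cauchy_transform_def)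
    next
      case False
      have "((\<lambda>z. \<integral>s. ?r z s ^ n \<partial>\<nu>) has_field_derivative - of_nat n * (\<integral>s. ?r z s ^ Suc n \<partial>\<mu>)) (at z)"
        by (rule has_field_derivative_transform_within_open
            [OF \<mu>.has_derivative_integral_resolvent_power[OF Suc.prems] open_upper_half_plane])
           (use Suc in auto)
      then have "- of_nat n * (\<integral>s. ?r z s ^ Suc n \<partial>\<mu>) = - of_nat n * (\<integral>s. ?r z s ^ Suc n \<partial>\<nu>)"
        using \<nu>.has_derivative_integral_resolvent_power[OF Suc.prems] by (rule DERIV_unique)
      then show ?thesis using False by simp
    qed
  qed
  \<comment> \<open>The evaluation point \<open>n / (\<i> * t)\<close> is
    \<open>- \<i> * n / t\<close>, which lies in the upper half-plane exactly for negative
    \<open>t\<close>.\<close>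
  have ImZ: "0 < Im (of_nat (Suc n) / (\<i> * of_real t))" if "t < 0" for n and t :: real
  proof -
    have "of_nat (Suc n) / (\<i> * of_real t) = \<i> * of_real (- real (Suc n) / t)"
      using that by (simp add: field_simps)
    then show ?thesis
      using that by (simp only:) (simp add: divide_neg_neg)
  qed
  have tends: "(\<lambda>n. (of_nat (Suc n) / (\<i> * of_real t)) ^ Suc n * (\<integral>s. ?r (of_nat (Suc n) / (\<i> * of_real t)) s ^ Suc n \<partial>M))
      \<longlonglongrightarrow> char M t" if "t < 0" "real_distribution M" for t M
  proof -
    interpret M: real_distribution M by fact
    note ImZ = ImZ[OF that(1)]
    have eq: "(of_nat (Suc n) / (\<i> * of_real t)) ^ Suc n * ?r (of_nat (Suc n) / (\<i> * of_real t)) s ^ Suc n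
       = (1 / (1 - \<i> * of_real (t * s) / of_nat (Suc n))) ^ Suc n" for n s
    proof -
      have "of_nat (Suc n) / (\<i> * of_real t) * ?r (of_nat (Suc n) / (\<i> * of_real t)) s 
         = 1 / (1 - \<i> * of_real (t * s) / of_nat (Suc n))"
        using that(1) minus_real_nonzero[OF ImZ[of n], of s]
        by (simp add: divide_simps del: of_nat_Suc)
      then show ?thesis by (simp only: flip: power_mult_distrib)
    qed
    have "(\<lambda>n. \<integral>s. (of_nat (Suc n) / (\<i> * of_real t)) ^ Suc n * ?r (of_nat (Suc n) / (\<i> * of_real t)) s ^ Suc n \<partial>M)
      \<longlonglongrightarrow> (\<integral>s. iexp (t * s) \<partial>M)"
    proof (rule integral_dominated_convergence)
      show "(\<lambda>s. iexp (t * s)) \<in> borel_measurable M" by simp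
      show "(\<lambda>s. (of_nat (Suc n) / (\<i> * of_real t)) ^ Suc n * ?r (of_nat (Suc n) / (\<i> * of_real t)) s ^ Suc n)
         \<in> borel_measurable M" for n
        by (intro borel_measurable_times borel_measurable_const borel_measurable_integrable
            M.integrable_resolvent_power ImZ)
      show "integrable M (\<lambda>s. 1 :: real)" by simp
      show "AE s in M. (\<lambda>n. (of_nat (Suc n) / (\<i> * of_real t)) ^ Suc n * ?r (of_nat (Suc n) / (\<i> * of_real t)) s ^ Suc n)
          \<longlonglongrightarrow> iexp (t * s)"
        unfolding eq by (intro always_eventually allI LIMSEQ_Suc[OF tendsto_resolvent_power_iexp])
      show "AE s in M. norm ((of_nat (Suc n) / (\<i> * of_real t)) ^ Suc n * ?r (of_nat (Suc n) / (\<i> * of_real t)) s ^ Suc n) \<le> 1"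
        for n
      proof (intro always_eventually allI)
        fix s
        have "1 \<le> cmod (1 - \<i> * of_real (t * s) / of_nat (Suc n))"
          using abs_Re_le_cmod[of "1 - \<i> * of_real (t * s) / of_nat (Suc n)"] by simp
        then show "norm ((of_nat (Suc n) / (\<i> * of_real t)) ^ Suc n * ?r (of_nat (Suc n) / (\<i> * of_real t)) s ^ Suc n) \<le> 1"
          unfolding eq norm_power by (intro power_le_one) (simp_all only: norm_divide norm_one, simp_all)
      qed
    qed
    then show ?thesis
      by (simp only: char_def integral_mult_right_zero)
  qed
  have neg: "char \<mu> t = char \<nu> t" if "t < 0" for t
  proof -
    show ?thesis
      using tends[OF that assms(1)] tends[OF that assms(2)]
      unfolding powers[OF ImZ[OF that]] by (rule LIMSEQ_unique)
  qed
  \<comment> \<open>Positive arguments are recovered from negative ones by conjugation.\<close>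
  have sym: "char M (- t) = cnj (char M t)" for M t
  proof -
    have "cnj (char M t) = (CLINT x|M. cnj (iexp (t * x)))"
      unfolding char_def by (rule Bochner_Integration.integral_cnj[symmetric])
    then show ?thesis by (simp add: char_def exp_cnj)
  qed
  have "char \<mu> t = char \<nu> t" for t
  proof -
    consider "t < 0" | "t = 0" | "t > 0" by linarith
    then show ?thesis
    proof cases
      case 2
      then show ?thesis by (simp add: \<mu>.char_zero \<nu>.char_zero)
    next
      case 3
      then show ?thesis using neg[of "- t"] by (simp add: sym)
    qed (rule neg)
  qed
  then show ?thesis
    by (intro Levy_uniqueness assms) auto
qed

subsection \<open>Reciprocal Cauchy transforms\<close>

text \<open>Nevanlinna's description of reciprocal Cauchy transforms. The limit is demanded on the
  imaginary axis only, which is easy to check for composed functions;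
  \<open>recip_cauchy_nontangential\<close> later recovers it on cones.\<close>

definition recip_cauchy :: "(complex \<Rightarrow> complex) \<Rightarrow> bool" where
  "recip_cauchy F \<longleftrightarrow> F holomorphic_on upper_half_plane \<and> (\<forall>z. 0 < Im z \<longrightarrow> 0 < Im (F z)) \<and>
     ((\<lambda>y. F (\<i> * of_real y) / (\<i> * of_real y)) \<longlongrightarrow> 1) at_top"

lemma recip_cauchyI:
  assumes "F holomorphic_on upper_half_plane" "\<And>z. 0 < Im z \<Longrightarrow> 0 < Im (F z)"
    "((\<lambda>y. F (\<i> * of_real y) / (\<i> * of_real y)) \<longlongrightarrow> 1) at_top"
  shows "recip_cauchy F"
  using assms by (auto simp: recip_cauchy_def)

lemma recip_cauchyD:
  assumes "recip_cauchy F"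
  shows "F holomorphic_on upper_half_plane" "\<And>z. 0 < Im z \<Longrightarrow> 0 < Im (F z)"
    "((\<lambda>y. F (\<i> * of_real y) / (\<i> * of_real y)) \<longlongrightarrow> 1) at_top"
  using assms by (auto simp: recip_cauchy_def)

text \<open>Schwarz--Pick between \<open>z\<close> and \<open>\<i>y\<close>, with \<open>y \<rightarrow> \<infinity>\<close>.\<close>

lemma recip_cauchy_Im_ge:
  assumes F: "recip_cauchy F" and z: "0 < Im z"
  shows "Im z \<le> Im (F z)"
proof -
  let ?y = "\<lambda>y. \<i> * complex_of_real y"
  define q where "q y = F (?y y) / ?y y" for y
  have q: "(q \<longlongrightarrow> 1) at_top"
    using recip_cauchyD(3)[OF F] by (simp add: q_def[abs_def])
  have inv: "((\<lambda>y. 1 / ?y y) \<longlongrightarrow> 0) at_top"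
  proof -
    have "((\<lambda>y. norm (1 / ?y y)) \<longlongrightarrow> 0) at_top"
      by (simp add: norm_divide norm_mult) real_asymp
    then show ?thesis by (rule tendsto_norm_zero_cancel)
  qed
  have "((\<lambda>y. (cmod (F z * (1 / ?y y) - q y))\<^sup>2 * Im z) \<longlongrightarrow> (cmod (F z * 0 - 1))\<^sup>2 * Im z) at_top"
    by (intro tendsto_intros inv q)
  moreover have "((\<lambda>y. (cmod (z * (1 / ?y y) - 1))\<^sup>2 * (Im (F z) * Re (q y)))
      \<longlongrightarrow> (cmod (z * 0 - 1))\<^sup>2 * (Im (F z) * Re 1)) at_top"
    by (intro tendsto_intros inv q)
  moreover have "\<forall>\<^sub>F y in at_top. (cmod (F z * (1 / ?y y) - q y))\<^sup>2 * Im z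
      \<le> (cmod (z * (1 / ?y y) - 1))\<^sup>2 * (Im (F z) * Re (q y))"
    using eventually_gt_at_top[of 0]
  proof eventually_elim
    case (elim y)
    have "(cmod (F z - F (?y y)))\<^sup>2 * (Im z * y) \<le> (cmod (z - ?y y))\<^sup>2 * (Im (F z) * Im (F (?y y)))"
      using schwarz_pick_open[OF recip_cauchyD(1,2)[OF F] z, of "?y y"] elim by simp
    moreover have "F (?y y) = q y * ?y y"
      using elim by (simp add: q_def)
    ultimately have "(cmod (F z - q y * ?y y))\<^sup>2 * (Im z * y)
        \<le> (cmod (z - ?y y))\<^sup>2 * (Im (F z) * (y * Re (q y)))"
      by (simp add: mult.commute)
    moreover have "F z - q y * ?y y = (F z * (1 / ?y y) - q y) * ?y y"
      and "z - ?y y = (z * (1 / ?y y) - 1) * ?y y"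
      using elim by (simp_all add: field_simps)
    ultimately have "(cmod (F z * (1 / ?y y) - q y) * y)\<^sup>2 * (Im z * y)
        \<le> (cmod (z * (1 / ?y y) - 1) * y)\<^sup>2 * (Im (F z) * (y * Re (q y)))"
      using elim by (simp only: norm_mult) simp
    \<comment> \<open>Writing \<open>F (\<i>y)\<close> as \<open>q y * \<i>y\<close> lets a factor
      \<open>y ^ 3\<close> be split off on both sides; what remains has a limit.\<close>
    then have "y ^ 3 * ((cmod (F z * (1 / ?y y) - q y))\<^sup>2 * Im z)
      \<le> y ^ 3 * ((cmod (z * (1 / ?y y) - 1))\<^sup>2 * (Im (F z) * Re (q y)))"
      by (simp add: power2_eq_square power3_eq_cube mult_ac)
    then show ?case
      using elim by (simp only: mult_le_cancel_left_pos zero_less_power)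
  qed
  ultimately show ?thesis
    using tendsto_le[OF trivial_limit_at_top_linorder] by fastforce
qed

lemma cauchy_transform_nonzero:
  "real_distribution \<mu> \<Longrightarrow> 0 < Im z \<Longrightarrow> cauchy_transform \<mu> z \<noteq> 0"
  using real_distribution.Im_cauchy_transform_neg[of \<mu> z] by auto

lemma F_transform_nontangential:
  assumes \<mu>: "real_distribution \<mu>" and e: "0 < e"
  shows "\<exists>R>0. \<forall>z. R \<le> Im z \<longrightarrow> cmod z \<le> c * Im z \<longrightarrow> cmod (F_transform \<mu> z - z) \<le> e * cmod z"
proof -
  \<comment> \<open>With \<open>u = z * G z\<close>, the bound 1/2 keeps \<open>cmod u\<close> at
    least 1/2, and then \<open>(1 - u) / u\<close> has modulus at most
    \<open>2 * d \<le> e\<close>.\<close>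
  define d where "d = min (1/2) (e / 2)"
  have d: "0 < d" "d \<le> 1/2" "2 * d \<le> e" using e by (auto simp: d_def)
  obtain R where R: "R > 0" "\<And>z. R \<le> Im z \<Longrightarrow> cmod z \<le> c * Im z \<Longrightarrow> cmod (z * cauchy_transform \<mu> z - 1) < d"
    using real_distribution.cauchy_transform_nontangential[OF \<mu> d(1), of c] by auto
  have "cmod (F_transform \<mu> z - z) \<le> e * cmod z" if z: "R \<le> Im z" "cmod z \<le> c * Im z" for z
  proof -
    let ?u = "z * cauchy_transform \<mu> z"
    have z0: "0 < Im z" using z R(1) by linarith
    then have nz: "z \<noteq> 0" and nG: "cauchy_transform \<mu> z \<noteq> 0"
      using cauchy_transform_nonzero[OF \<mu>] by auto
    have u: "cmod (?u - 1) < d" using R(2) z by blast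
    have "1/2 \<le> cmod ?u"
      using norm_triangle_ineq2[of 1 "1 - ?u"] u d by (simp add: norm_minus_commute)
    then have "cmod (1 - ?u) / cmod ?u \<le> d / (1/2)"
      using u d by (intro frac_le) (auto simp: norm_minus_commute)
    then have "cmod ((1 - ?u) / ?u) \<le> e"
      using d by (simp add: norm_divide)
    moreover have "F_transform \<mu> z - z = z * ((1 - ?u) / ?u)"
      using nz nG by (simp add: F_transform_def field_simps)
    ultimately show ?thesis
      by (simp only: norm_mult mult.commute[of "cmod z"] mult_right_mono norm_ge_zero)
  qed
  then show ?thesis using R(1) by blast
qed

lemma recip_cauchy_F_transform:
  assumes \<mu>: "real_distribution \<mu>"
  shows "recip_cauchy (F_transform \<mu>)"
proof (rule recip_cauchyI)
  show "F_transform \<mu> holomorphic_on upper_half_plane"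
    unfolding F_transform_def[abs_def]
    using cauchy_transform_nonzero[OF \<mu>] real_distribution.holomorphic_cauchy_transform[OF \<mu>]
    by (auto intro!: holomorphic_intros)
  show "0 < Im (F_transform \<mu> z)" if "0 < Im z" for z
  proof -
    have "0 < - Im (cauchy_transform \<mu> z) / (cmod (cauchy_transform \<mu> z))\<^sup>2"
      using real_distribution.Im_cauchy_transform_neg[OF \<mu> that] cauchy_transform_nonzero[OF \<mu> that]
      by (intro divide_pos_pos) auto
    then show ?thesis
      by (simp add: F_transform_def Im_divide cmod_power2)
  qed
  show "((\<lambda>y. F_transform \<mu> (\<i> * of_real y) / (\<i> * of_real y)) \<longlongrightarrow> 1) at_top"
  proof (rule tendstoI)
    fix e :: real assume "0 < e"
    then obtain R where R: "R > 0"
        "\<And>z. R \<le> Im z \<Longrightarrow> cmod z \<le> 1 * Im z \<Longrightarrow> cmod (F_transform \<mu> z - z) \<le> e / 2 * cmod z"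
      using F_transform_nontangential[OF \<mu>, of "e / 2" 1] by auto
    show "\<forall>\<^sub>F y in at_top. dist (F_transform \<mu> (\<i> * of_real y) / (\<i> * of_real y)) 1 < e"
      using eventually_ge_at_top[of R]
    proof eventually_elim
      case (elim y)
      let ?z = "\<i> * complex_of_real y"
      have y: "0 < y" using elim R(1) by linarith
      have "cmod (F_transform \<mu> ?z - ?z) / cmod ?z \<le> e / 2"
        using R(2)[of ?z] elim y by (simp add: norm_mult divide_simps)
      moreover have "F_transform \<mu> ?z / ?z - 1 = (F_transform \<mu> ?z - ?z) / ?z"
        using y by (simp add: field_simps)
      ultimately show ?case
        using \<open>0 < e\<close> by (simp only: dist_norm norm_divide)
    qed
  qed
qed

lemma F_transform_inject:
  assumes "real_distribution \<mu>" "real_distribution \<nu>"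
    and "\<And>z. 0 < Im z \<Longrightarrow> F_transform \<mu> z = F_transform \<nu> z"
  shows "\<mu> = \<nu>"
  by (rule cauchy_transform_inject[OF assms(1,2)]) (use assms(3) in \<open>simp add: F_transform_def\<close>)

subsection \<open>The Poisson formula and Nevanlinna representation\<close>

lemma integral_cauchy_density:
  fixes a b :: real
  assumes b: "0 < b"
  shows "integrable lborel (\<lambda>x. b / ((a - x)\<^sup>2 + b\<^sup>2))"
    and "(\<integral>x. b / ((a - x)\<^sup>2 + b\<^sup>2) \<partial>lborel) = pi"
proof -
  let ?f = "\<lambda>x. b / ((a - x)\<^sup>2 + b\<^sup>2)"
  let ?F = "\<lambda>x. arctan ((x - a) / b)"
  have nz: "(a - x)\<^sup>2 + b\<^sup>2 \<noteq> 0" for x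
    using b by (simp add: sum_power2_eq_zero_iff)
  have der: "DERIV ?F x :> ?f x" for x
  proof -
    have "inverse (1 + ((x - a) / b)\<^sup>2) * (1 / b) = ?f x"
      using b nz[of x] by (simp add: divide_simps power2_eq_square) (simp add: algebra_simps)
    then show ?thesis
      using b by (auto intro!: derivative_eq_intros simp: field_simps)
  qed
  have lims: "((?F \<circ> real_of_ereal) \<longlongrightarrow> - (pi / 2)) (at_right (-\<infinity>))"
    "((?F \<circ> real_of_ereal) \<longlongrightarrow> pi / 2) (at_left \<infinity>)"
    using b unfolding ereal_tendsto_simps1
    by (intro filterlim_compose[OF tendsto_arctan_at_bot] filterlim_compose[OF tendsto_arctan_at_top], real_asymp)+
  have "set_integrable lborel (einterval (-\<infinity>) \<infinity>) ?f" "(LBINT x=-\<infinity>..\<infinity>. ?f x) = pi / 2 - - (pi / 2)"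
    using b nz by (intro interval_integral_FTC_nonneg[OF _ der _ _ lims]; auto intro!: AE_I2 continuous_intros)+
  then show "integrable lborel ?f" "(\<integral>x. ?f x \<partial>lborel) = pi"
    by (simp_all add: set_integrable_def interval_lebesgue_integral_def set_lebesgue_integral_def)
qed

text \<open>Cauchy's theorem on a large half disc for
  \<open>(g s - g z) / ((s - z) * (s - cnj z))\<close>. Subtracting \<open>g z\<close> removes the
  pole at \<open>z\<close>, the other pole lies below the axis, and the integrand is of order
  \<open>1 / R^2\<close> on the arc. On the real line the denominator is the Poisson one. Holomorphy
  slightly below the axis lets the contour run along it.\<close>

lemma poisson_integral_half_plane:
  assumes e: "0 < e" and holg: "g holomorphic_on {s. - e < Im s}"
    and bound: "\<And>s. 0 \<le> Im s \<Longrightarrow> cmod (g s) \<le> B"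
    and z: "0 < Im z"
  shows "integrable lborel (\<lambda>x. (g (of_real x) - g z) / of_real ((Re z - x)\<^sup>2 + (Im z)\<^sup>2))"
    and "(\<integral>x. (g (of_real x) - g z) / of_real ((Re z - x)\<^sup>2 + (Im z)\<^sup>2) \<partial>lborel) = 0"
proof -
  have B: "0 \<le> B"
    using bound[of 0] order_trans[OF norm_ge_zero] by auto
  \<comment> \<open>The minimum with \<open>Im z\<close> excludes the pole
    \<open>cnj z\<close>.\<close>
  define S where "S = {s. - min e (Im z) < Im s}"
  define \<phi> where "\<phi> s = (if s = z then deriv g z else (g s - g z) / (s - z)) / (s - cnj z)" for s
  define h where "h x = (g (of_real x) - g z) / of_real ((Re z - x)\<^sup>2 + (Im z)\<^sup>2)" for x :: real
  have S: "open S" "convex S" 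
    unfolding S_def by (rule open_halfspace_Im_gt convex_halfspace_Im_gt)+
  have "g holomorphic_on S"
    using holg by (rule holomorphic_on_subset) (auto simp: S_def)
  then have hol\<phi>: "\<phi> holomorphic_on S"
    unfolding \<phi>_def[abs_def]
    by (intro holomorphic_on_divide pole_lemma_open S holomorphic_intros) (use z in \<open>auto simp: S_def\<close>)
  have \<phi>h: "\<phi> (of_real x) = h x" for x
  proof -
    have "(of_real x - z) * (of_real x - cnj z) = of_real ((Re z - x)\<^sup>2 + (Im z)\<^sup>2)"
      by (simp add: complex_eq_iff power2_eq_square algebra_simps)
    then show ?thesis
      using z by (auto simp: \<phi>_def h_def)
  qed
  have cont: "continuous_on UNIV h"
  proof -
    have "continuous_on UNIV (\<lambda>x. \<phi> (complex_of_real x))"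
      using e z by (intro continuous_on_compose2[OF holomorphic_on_imp_continuous_on[OF hol\<phi>]])
        (auto simp: S_def intro!: continuous_intros)
    then show ?thesis by (simp add: \<phi>h)
  qed
  have hbound: "norm (h x) \<le> 2 * B / Im z * (Im z / ((Re z - x)\<^sup>2 + (Im z)\<^sup>2))" for x
  proof -
    have "cmod (g (of_real x) - g z) \<le> 2 * B"
      using bound[of "of_real x"] bound[of z] z norm_triangle_ineq4[of "g (of_real x)" "g z"] by simp
    moreover have "0 < (Re z - x)\<^sup>2 + (Im z)\<^sup>2"
      using z by (intro add_nonneg_pos) auto
    ultimately show ?thesis
      using z unfolding h_def norm_divide norm_of_real by (simp add: divide_right_mono)
  qed
  have int: "integrable lborel h"
  proof (rule Bochner_Integration.integrable_bound
      [of lborel "\<lambda>x. 2 * B / Im z * (Im z / ((Re z - x)\<^sup>2 + (Im z)\<^sup>2))"])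
    show "integrable lborel (\<lambda>x. 2 * B / Im z * (Im z / ((Re z - x)\<^sup>2 + (Im z)\<^sup>2)))"
      by (rule integrable_mult_right[OF integral_cauchy_density(1)[OF z]])
    show "h \<in> borel_measurable lborel"
      using borel_measurable_continuous_onI[OF cont] by simp
    show "AE x in lborel. norm (h x) \<le> norm (2 * B / Im z * (Im z / ((Re z - x)\<^sup>2 + (Im z)\<^sup>2)))"
      using order_trans[OF hbound abs_ge_self] by (intro always_eventually allI) (simp only: real_norm_def)
  qed
  \<comment> \<open>For \<open>R > 2 * cmod z\<close> both factors of the denominator are at least
    \<open>R / 2\<close> on the arc.\<close>
  have arc: "cmod (integral {- R..R} h) \<le> 8 * B * pi / R" if R: "2 * cmod z < R" for R
  proof -
    have R0: "0 < R" using R norm_ge_zero[of z] by linarith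
    have sub1: "path_image (part_circlepath 0 R 0 pi) \<subseteq> S"
      using R0 e z by (auto simp: S_def path_image_part_circlepath Im_exp
          intro!: less_le_trans[OF _ mult_nonneg_nonneg] sin_ge_zero)
    have sub2: "path_image (linepath (of_real (- R)) (of_real R)) \<subseteq> S"
      unfolding path_image_linepath
      by (rule closed_segment_subset[OF _ _ S(2)]) (use e z in \<open>auto simp: S_def\<close>)
    have ends: "pathfinish (part_circlepath 0 R 0 pi) = pathstart (linepath (of_real (- R)) (of_real R))"
      by simp
    have ci1: "\<phi> contour_integrable_on part_circlepath 0 R 0 pi"
      by (rule contour_integrable_holomorphic_simple[OF hol\<phi> S(1) _ sub1]) auto
    have ci2: "\<phi> contour_integrable_on linepath (of_real (- R)) (of_real R)"
      by (rule contour_integrable_holomorphic_simple[OF hol\<phi> S(1) _ sub2]) auto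
    have "(\<phi> has_contour_integral 0) (part_circlepath 0 R 0 pi +++ linepath (of_real (- R)) (of_real R))"
      using sub1 sub2
      by (intro Cauchy_theorem_convex_simple[OF hol\<phi> S(2)] valid_path_join)
         (auto simp: path_image_join)
    then have sum0: "contour_integral (part_circlepath 0 R 0 pi) \<phi>
        + contour_integral (linepath (of_real (- R)) (of_real R)) \<phi> = 0"
      using ci1 ci2 by (simp add: contour_integral_join contour_integral_unique flip: contour_integral_join)
    have "contour_integral (linepath (of_real (- R)) (of_real R)) \<phi> = integral {- R..R} h"
      using R0 by (subst contour_integral_linepath_Reals_eq) (auto simp: \<phi>h simp del: of_real_minus)
    then have eq: "cmod (integral {- R..R} h) = cmod (contour_integral (part_circlepath 0 R 0 pi) \<phi>)"
      using sum0 by (simp add: add_eq_0_iff norm_minus_commute)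
    have "cmod (\<phi> s) \<le> 8 * B / R\<^sup>2" if s: "s \<in> path_image (part_circlepath 0 R 0 pi)" for s
    proof -
      have cs: "cmod s = R"
        using in_path_image_part_circlepath[OF s] R0 by simp
      have Ims: "0 \<le> Im s"
        using s R0 by (auto simp: path_image_part_circlepath Im_exp intro!: mult_nonneg_nonneg sin_ge_zero)
      have d: "R / 2 \<le> cmod (s - z)" "R / 2 \<le> cmod (s - cnj z)"
        using norm_triangle_ineq2[of s z] norm_triangle_ineq2[of s "cnj z"] cs R by auto
      have "cmod (g s - g z) \<le> 2 * B"
        using bound[OF Ims] bound[of z] z norm_triangle_ineq4[of "g s" "g z"] by simp
      then have "cmod (g s - g z) / (cmod (s - z) * cmod (s - cnj z)) \<le> 2 * B / (R / 2 * (R / 2))"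
        using d R0 B by (intro frac_le mult_mono mult_pos_pos) auto
      moreover have "s \<noteq> z" using d(1) R0 by auto
      ultimately show ?thesis
        by (simp add: \<phi>_def norm_divide norm_mult power2_eq_square)
    qed
    then have "cmod (contour_integral (part_circlepath 0 R 0 pi) \<phi>) \<le> 8 * B / R\<^sup>2 * R * \<bar>pi - 0\<bar>"
      by (intro contour_integral_bound_part_circlepath ci1) (use R0 B in auto)
    then show ?thesis
      unfolding eq using R0 by (simp add: power2_eq_square)
  qed
  have "(\<lambda>n. \<integral>x. indicator {- real n..real n} x *\<^sub>R h x \<partial>lborel) \<longlonglongrightarrow> (\<integral>x. h x \<partial>lborel)"
  proof (rule integral_dominated_convergence[where w = "\<lambda>x. norm (h x)"])
    show "AE x in lborel. (\<lambda>n. indicator {- real n..real n} x *\<^sub>R h x) \<longlonglongrightarrow> h x"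
    proof (rule AE_I2, rule tendsto_eventually)
      fix x :: real
      show "\<forall>\<^sub>F n in sequentially. indicator {- real n..real n} x *\<^sub>R h x = h x"
        using eventually_ge_at_top[of "nat \<lceil>\<bar>x\<bar>\<rceil>"]
        by eventually_elim (auto simp: indicator_def; linarith)
    qed
  qed (use int in \<open>auto simp: indicator_def intro!: borel_measurable_scaleR\<close>)
  moreover have "(\<integral>x. indicator {- real n..real n} x *\<^sub>R h x \<partial>lborel) = integral {- real n..real n} h" for n
  proof -
    have "set_integrable lborel {- real n..real n} h"
      unfolding set_integrable_def using int by (intro integrable_mult_indicator) auto
    from set_borel_integral_eq_integral(2)[OF this] show ?thesis
      by (simp add: set_lebesgue_integral_def)
  qed
  ultimately have lim: "(\<lambda>n. integral {- real n..real n} h) \<longlonglongrightarrow> (\<integral>x. h x \<partial>lborel)"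
    by simp
  have "(\<lambda>n. integral {- real n..real n} h) \<longlonglongrightarrow> 0"
  proof (rule Lim_null_comparison)
    show "(\<lambda>n. 8 * B * pi / real n) \<longlonglongrightarrow> 0"
      by real_asymp
    show "\<forall>\<^sub>F n in sequentially. norm (integral {- real n..real n} h) \<le> 8 * B * pi / real n"
      using eventually_gt_at_top[of "nat \<lceil>2 * cmod z\<rceil>"]
      by eventually_elim (intro arc, linarith)
  qed
  with lim have "(\<integral>x. h x \<partial>lborel) = 0"
    by (rule LIMSEQ_unique)
  with int show "integrable lborel (\<lambda>x. (g (of_real x) - g z) / of_real ((Re z - x)\<^sup>2 + (Im z)\<^sup>2))"
    and "(\<integral>x. (g (of_real x) - g z) / of_real ((Re z - x)\<^sup>2 + (Im z)\<^sup>2) \<partial>lborel) = 0"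
    by (simp_all only: h_def[abs_def])
qed

lemma poisson_integral_Im:
  assumes e: "0 < e" and holg: "g holomorphic_on {s. - e < Im s}"
    and bound: "\<And>s. 0 \<le> Im s \<Longrightarrow> cmod (g s) \<le> B"
    and z: "0 < Im z"
  shows "integrable lborel (\<lambda>x. Im z / ((Re z - x)\<^sup>2 + (Im z)\<^sup>2) * Im (g (of_real x)))"
    and "(\<integral>x. Im z / ((Re z - x)\<^sup>2 + (Im z)\<^sup>2) * Im (g (of_real x)) \<partial>lborel) = pi * Im (g z)"
proof -
  note P = poisson_integral_half_plane[OF assms]
  let ?h = "\<lambda>x. (g (of_real x) - g z) / of_real ((Re z - x)\<^sup>2 + (Im z)\<^sup>2)"
  let ?k = "\<lambda>x. Im z / ((Re z - x)\<^sup>2 + (Im z)\<^sup>2)"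
  have eq: "?k x * Im (g (of_real x)) = Im z * Im (?h x) + ?k x * Im (g z)" for x
    by (simp only: Im_divide_of_real) (simp add: diff_divide_distrib right_diff_distrib)
  have i: "integrable lborel (\<lambda>x. Im z * Im (?h x))"
    by (rule integrable_mult_right[OF integrable_Im[OF P(1)]])
  have j: "integrable lborel (\<lambda>x. ?k x * Im (g z))"
    by (rule integrable_mult_left[OF integral_cauchy_density(1)[OF z]])
  show "integrable lborel (\<lambda>x. ?k x * Im (g (of_real x)))"
    unfolding eq by (intro Bochner_Integration.integrable_add i j)
  have "(\<integral>x. ?k x * Im (g (of_real x)) \<partial>lborel)
      = (\<integral>x. Im z * Im (?h x) \<partial>lborel) + (\<integral>x. ?k x * Im (g z) \<partial>lborel)"
    unfolding eq by (rule Bochner_Integration.integral_add[OF i j])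
  also have "(\<integral>x. Im z * Im (?h x) \<partial>lborel) = Im z * Im (\<integral>x. ?h x \<partial>lborel)"
    by (simp only: integral_mult_right_zero integral_Im[OF P(1)])
  also have "(\<integral>x. ?k x * Im (g z) \<partial>lborel) = pi * Im (g z)"
    by (simp only: integral_mult_left_zero integral_cauchy_density(2)[OF z])
  finally show "(\<integral>x. ?k x * Im (g (of_real x)) \<partial>lborel) = pi * Im (g z)"
    by (simp only: P(2)) simp
qed

section \<open>Measures with a prescribed transform\<close>

lemma (in real_distribution) cmod_cauchy_transform_le:
  assumes z: "0 < Im z"
  shows "cmod (cauchy_transform M z) \<le> 1 / Im z"
proof -
  have "cmod (cauchy_transform M z) \<le> (\<integral>s. cmod (1 / (z - complex_of_real s)) \<partial>M)"
    unfolding cauchy_transform_def by (rule integral_norm_bound)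
  also have "\<dots> \<le> (\<integral>s. 1 / Im z \<partial>M)"
    using integrable_resolvent[OF z] cmod_resolvent_le[OF z]
    by (intro integral_mono integrable_norm) auto
  also have "\<dots> = 1 / Im z"
    by (simp add: prob_space del: space_eq_univ)
  finally show ?thesis .
qed

text \<open>The measure has density \<open>- Im g / \<pi>\<close>; the Poisson formula identifies the imaginary
  parts, hence the functions up to a real constant, which vanishes at infinity.\<close>

lemma cauchy_transform_of_boundary_values:
  assumes e: "0 < e" and holg: "g holomorphic_on {s. - e < Im s}"
    and bound: "\<And>s. - e < Im s \<Longrightarrow> cmod (g s) \<le> 1 / (Im s + e)"
    and nonpos: "\<And>s. - e < Im s \<Longrightarrow> Im (g s) \<le> 0"
    and lim: "((\<lambda>y. y * Im (g (\<i> * of_real y))) \<longlongrightarrow> - 1) at_top"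
  shows "\<exists>\<mu>. real_distribution \<mu> \<and> (\<forall>z. 0 < Im z \<longrightarrow> cauchy_transform \<mu> z = g z)"
proof -
  define f where "f x = - Im (g (of_real x)) / pi" for x :: real
  define \<mu> where "\<mu> = density lborel (\<lambda>x. ennreal (f x))"
  have bound': "cmod (g s) \<le> 1 / e" if "0 \<le> Im s" for s
    using bound[of s] that e by (intro order_trans[OF bound]) (auto intro!: divide_left_mono)
  have f0: "0 \<le> f x" for x
    using nonpos[of "of_real x"] e by (simp add: f_def divide_nonpos_pos)
  have "continuous_on UNIV (\<lambda>x. g (complex_of_real x))"
    using e by (intro continuous_on_compose2[OF holomorphic_on_imp_continuous_on[OF holg]])
      (auto intro!: continuous_intros)
  then have "continuous_on UNIV f"
    unfolding f_def[abs_def] by (intro continuous_intros) auto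
  then have fm [measurable]: "f \<in> borel_measurable borel"
    by (rule borel_measurable_continuous_onI)
  note P = poisson_integral_Im[OF e holg bound']
  have poisson: "integrable lborel (\<lambda>x. Im z / ((Re z - x)\<^sup>2 + (Im z)\<^sup>2) * f x)"
    "(\<integral>x. Im z / ((Re z - x)\<^sup>2 + (Im z)\<^sup>2) * f x \<partial>lborel) = - Im (g z)" if z: "0 < Im z" for z
  proof -
    have eq: "Im z / ((Re z - x)\<^sup>2 + (Im z)\<^sup>2) * f x =
        - (1 / pi) * (Im z / ((Re z - x)\<^sup>2 + (Im z)\<^sup>2) * Im (g (of_real x)))" for x
      by (simp add: f_def)
    show "integrable lborel (\<lambda>x. Im z / ((Re z - x)\<^sup>2 + (Im z)\<^sup>2) * f x)"
      unfolding eq by (rule integrable_mult_right[OF P(1)[OF _ z]])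
    show "(\<integral>x. Im z / ((Re z - x)\<^sup>2 + (Im z)\<^sup>2) * f x \<partial>lborel) = - Im (g z)"
      unfolding eq using P(2)[OF _ z] by (simp only: integral_mult_right_zero) simp
  qed
  \<comment> \<open>\<open>k n\<close> is \<open>n^2 / (x^2 + n^2) * f x\<close>, which increases to
    \<open>f x\<close>. By the Poisson formula at \<open>\<i> * n\<close> its integral is
    \<open>- n * Im (g (\<i> * n))\<close>, which tends to 1. Monotone convergence thus gives total
    mass 1.\<close>
  define k where "k n x = real n * (real n / ((0 - x)\<^sup>2 + (real n)\<^sup>2) * f x)" for n x
  have k0: "0 \<le> k n x" for n x
    unfolding k_def using f0 by (intro mult_nonneg_nonneg divide_nonneg_nonneg) auto
  have km [measurable]: "k n \<in> borel_measurable borel" for n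
    unfolding k_def[abs_def] by measurable
  have "(\<lambda>n. \<integral>\<^sup>+x. ennreal (k n x) \<partial>lborel) \<longlonglongrightarrow> (\<integral>\<^sup>+x. ennreal (f x) \<partial>lborel)"
  proof (rule nn_integral_LIMSEQ)
    show "incseq (\<lambda>n x. ennreal (k n x))"
    proof (rule incseq_SucI, rule le_funI, rule ennreal_leI)
      fix n and x :: real
      have mono: "a * (a / (x\<^sup>2 + a\<^sup>2)) \<le> b * (b / (x\<^sup>2 + b\<^sup>2))" if "0 \<le> a" "a < b" for a b :: real
      proof -
        have "0 < x\<^sup>2 + b\<^sup>2" using that by (intro add_nonneg_pos) auto
        moreover have "a\<^sup>2 * x\<^sup>2 \<le> b\<^sup>2 * x\<^sup>2"
          using that by (intro mult_right_mono power_mono) auto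
        ultimately show ?thesis
          using that by (cases "x\<^sup>2 + a\<^sup>2 = 0")
             (auto simp: divide_simps power2_eq_square algebra_simps not_sum_squares_lt_zero)
      qed
      show "k n x \<le> k (Suc n) x"
        unfolding k_def using mult_right_mono[OF mono[of "real n" "real (Suc n)"] f0[of x]]
        by (simp add: mult.assoc)
    qed
    show "(\<lambda>n. ennreal (k n x)) \<longlonglongrightarrow> ennreal (f x)" for x
    proof (rule tendsto_ennrealI)
      have "(\<lambda>n. real n * (real n / ((0 - x)\<^sup>2 + (real n)\<^sup>2)) * f x) \<longlonglongrightarrow> 1 * f x"
        by (intro tendsto_intros) real_asymp
      then show "(\<lambda>n. k n x) \<longlonglongrightarrow> f x"
        by (simp add: k_def mult.assoc)
    qed
  qed measurable
  moreover have "(\<lambda>n. \<integral>\<^sup>+x. ennreal (k n x) \<partial>lborel) \<longlonglongrightarrow> 1"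
  proof (rule Lim_transform_eventually)
    have "(\<lambda>n. ennreal (- (real n * Im (g (\<i> * of_real (real n)))))) \<longlonglongrightarrow> ennreal (- (- 1))"
      by (intro tendsto_ennrealI tendsto_minus filterlim_compose[OF lim filterlim_real_sequentially])
    then show "(\<lambda>n. ennreal (- (real n * Im (g (\<i> * of_real (real n)))))) \<longlonglongrightarrow> 1"
      by simp
    show "\<forall>\<^sub>F n in sequentially. ennreal (- (real n * Im (g (\<i> * of_real (real n))))) =
        (\<integral>\<^sup>+x. ennreal (k n x) \<partial>lborel)"
      using eventually_gt_at_top[of 0]
    proof eventually_elim
      case (elim n)
      have p: "0 < Im (\<i> * complex_of_real (real n))" using elim by simp
      have "integrable lborel (k n)" "(\<integral>x. k n x \<partial>lborel) = - (real n * Im (g (\<i> * of_real (real n))))"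
        unfolding k_def[abs_def]
        using integrable_mult_right[OF poisson(1)[OF p], of "real n"] poisson(2)[OF p]
        by (simp_all only: integral_mult_right_zero) simp_all
      then show ?case
        using nn_integral_eq_integral[of lborel "k n"] k0 by simp
    qed
  qed
  ultimately have "(\<integral>\<^sup>+x. ennreal (f x) \<partial>lborel) = 1"
    by (rule LIMSEQ_unique)
  then have "emeasure \<mu> (space \<mu>) = 1"
    unfolding \<mu>_def by (subst emeasure_density) auto
  then have \<mu>: "real_distribution \<mu>"
    by (intro real_distribution.intro prob_spaceI real_distribution_axioms.intro) (auto simp: \<mu>_def)
  then interpret \<mu>: real_distribution \<mu> .
  define D where "D z = cauchy_transform \<mu> z - g z" for z
  have ImD: "Im (D z) = 0" if z: "0 < Im z" for z
  proof -
    have "(\<integral>s. Im z / ((Re z - s)\<^sup>2 + (Im z)\<^sup>2) \<partial>\<mu>) = (\<integral>s. f s *\<^sub>R (Im z / ((Re z - s)\<^sup>2 + (Im z)\<^sup>2)) \<partial>lborel)"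
      unfolding \<mu>_def using f0 by (intro integral_density) auto
    also have "\<dots> = - Im (g z)"
      using poisson(2)[OF z] by (simp add: mult.commute)
    finally show ?thesis
      using \<mu>.Im_cauchy_transform(1)[OF z] by (simp add: D_def)
  qed
  have holD: "D holomorphic_on upper_half_plane"
    unfolding D_def[abs_def] using e
    by (intro holomorphic_intros \<mu>.holomorphic_cauchy_transform holomorphic_on_subset[OF holg]) auto
  \<comment> \<open>Schwarz-Pick with vanishing imaginary parts leaves 0 on the right-hand
    side.\<close>
  have const: "D z = D w" if z: "0 < Im z" and w: "0 < Im w" for z w
    using schwarz_pick[OF holD _ z w] ImD that by (simp add: mult_le_0_iff not_le)
  have "D z = 0" if z: "0 < Im z" for z
  proof -
    have "((\<lambda>y. 2 / y) \<longlongrightarrow> (0::real)) at_top"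
      by real_asymp
    moreover have "\<forall>\<^sub>F y in at_top. cmod (D z) \<le> 2 / y"
      using eventually_gt_at_top[of 0]
    proof eventually_elim
      case (elim y)
      have p: "0 < Im (\<i> * complex_of_real y)" using elim by simp
      have "cmod (g (\<i> * of_real y)) \<le> 1 / y"
        using bound[of "\<i> * of_real y"] elim e by (intro order_trans[OF bound]) (auto intro!: divide_left_mono)
      then have "cmod (D (\<i> * of_real y)) \<le> 2 / y"
        using \<mu>.cmod_cauchy_transform_le[OF p] norm_triangle_ineq4[of "cauchy_transform \<mu> (\<i> * of_real y)" "g (\<i> * of_real y)"]
        by (simp add: D_def)
      then show ?case using const[OF z p] by simp
    qed
    ultimately have "cmod (D z) \<le> 0"
      by (intro tendsto_lowerbound[where F = at_top]) auto
    then show ?thesis by simp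
  qed
  then show ?thesis
    using \<mu> by (auto simp: D_def)
qed

text \<open>The tightness estimate: \<open>2 * y^2 / (s^2 + y^2)\<close> is at most 2 everywhere and
  at most 1 for \<open>\<bar>s\<bar> \<ge> y\<close>. The lower bound approaches 1 when
  \<open>y * Im (G (\<i>y))\<close> approaches -1.\<close>

lemma (in real_distribution) measure_interval_ge_Im_cauchy_transform:
  assumes y: "0 < y"
  shows "- 1 - 2 * (y * Im (cauchy_transform M (\<i> * of_real y))) \<le> measure M {- y<..y}"
proof -
  let ?k = "\<lambda>s. y / ((0 - s)\<^sup>2 + y\<^sup>2)"
  have p: "0 < Im (\<i> * complex_of_real y)" using y by simp
  have int: "integrable M ?k"
    and eq: "Im (cauchy_transform M (\<i> * of_real y)) = - (\<integral>s. ?k s \<partial>M)"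
    using Im_cauchy_transform[OF p] by simp_all
  have le: "2 * (y * ?k s) \<le> 1 + indicat_real {- y<..y} s" for s
  proof -
    have pos: "0 < s\<^sup>2 + y\<^sup>2" using y by (intro add_nonneg_pos) auto
    show ?thesis
    proof (cases "s \<in> {- y<..y}")
      case True
      then show ?thesis using pos by (simp add: divide_simps power2_eq_square)
    next
      case False
      then have "\<bar>y\<bar> \<le> \<bar>s\<bar>" using y by auto
      then have "y\<^sup>2 \<le> s\<^sup>2" by (simp only: abs_le_square_iff)
      then show ?thesis using False pos by (simp add: divide_simps power2_eq_square)
    qed
  qed
  have "(\<integral>s. 2 * (y * ?k s) \<partial>M) \<le> (\<integral>s. 1 + indicat_real {- y<..y} s \<partial>M)"
    using le by (intro integral_mono integrable_mult_right int Bochner_Integration.integrable_add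
        integrable_const integrable_real_indicator) (auto simp: less_top[symmetric])
  also have "\<dots> = 1 + measure M {- y<..y}"
    using prob_space by (subst Bochner_Integration.integral_add) (auto simp: less_top[symmetric])
  finally show ?thesis
    unfolding eq by (simp only: integral_mult_right_zero)
qed

text \<open>\<open>G = 1 / F\<close> may have no boundary values on the real line. Shifting it
  upwards by \<open>e n\<close> makes it holomorphic across the line, which gives measures
  \<open>\<mu> n\<close>; the limit at infinity makes them tight, and a weak limit has Cauchy
  transform \<open>G\<close>.\<close>

theorem recip_cauchy_imp_F_transform:
  assumes F: "recip_cauchy F"
  shows "\<exists>\<mu>. real_distribution \<mu> \<and> (\<forall>z. 0 < Im z \<longrightarrow> F_transform \<mu> z = F z)"
proof -
  define G where "G z = 1 / F z" for z
  have Fge: "Im z \<le> Im (F z)" "0 < Im (F z)" "F z \<noteq> 0" if "0 < Im z" for z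
    using recip_cauchy_Im_ge[OF F that] recip_cauchyD(2)[OF F that] by auto
  have holG: "G holomorphic_on upper_half_plane"
    unfolding G_def[abs_def] using Fge(3) recip_cauchyD(1)[OF F] by (auto intro!: holomorphic_intros)
  have boundG: "cmod (G z) \<le> 1 / Im z" if "0 < Im z" for z
    using Fge[OF that] that abs_Im_le_cmod[of "F z"]
    by (auto simp: G_def norm_divide intro!: divide_left_mono mult_pos_pos)
  have ImG: "Im (G z) \<le> 0" if "0 < Im z" for z
    using Fge(2)[OF that] by (simp add: G_def Im_divide)
  have limG: "((\<lambda>y. y * Im (G (\<i> * of_real y))) \<longlongrightarrow> - 1) at_top"
  proof -
    have "((\<lambda>y. Im (- \<i> * (1 / (F (\<i> * of_real y) / (\<i> * of_real y))))) \<longlongrightarrow> Im (- \<i> * (1 / 1))) at_top"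
      by (intro tendsto_intros recip_cauchyD(3)[OF F]) auto
    moreover have "- \<i> * (1 / (F (\<i> * of_real y) / (\<i> * of_real y))) = of_real y * G (\<i> * of_real y)" for y
      by (simp add: G_def)
    ultimately show ?thesis by simp
  qed
  define e where "e n = 1 / real (Suc n)" for n
  have e: "0 < e n" "e n \<le> 1" for n
    by (auto simp: e_def)
  define g where "g n s = G (s + \<i> * of_real (e n))" for n s
  have limg: "((\<lambda>y. y * Im (g n (\<i> * of_real y))) \<longlongrightarrow> - 1) at_top" for n
  proof -
    have "filterlim (\<lambda>y. y + e n) at_top at_top"
      by real_asymp
    then have "((\<lambda>y. (y + e n) * Im (G (\<i> * of_real (y + e n)))) \<longlongrightarrow> - 1) at_top"
      by (rule filterlim_compose[OF limG])
    moreover have "((\<lambda>y. y / (y + e n)) \<longlongrightarrow> 1) at_top"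
      by real_asymp
    ultimately have "((\<lambda>y. (y / (y + e n)) * ((y + e n) * Im (G (\<i> * of_real (y + e n))))) \<longlongrightarrow> 1 * - 1) at_top"
      by (intro tendsto_mult)
    moreover have "\<forall>\<^sub>F y in at_top. (y / (y + e n)) * ((y + e n) * Im (G (\<i> * of_real (y + e n))))
        = y * Im (g n (\<i> * of_real y))"
      using eventually_gt_at_top[of 0]
    proof eventually_elim
      case (elim y)
      have "y + e n \<noteq> 0" using elim e[of n] by linarith
      moreover have "g n (\<i> * of_real y) = G (\<i> * of_real (y + e n))"
        by (simp add: g_def distrib_left)
      ultimately show ?case by (simp only: mult.assoc[symmetric]) simp
    qed
    ultimately show ?thesis
      using Lim_transform_eventually by fastforce
  qed
  have "\<exists>\<mu>. real_distribution \<mu> \<and> (\<forall>z. 0 < Im z \<longrightarrow> cauchy_transform \<mu> z = g n z)" for n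
  proof (rule cauchy_transform_of_boundary_values[OF e(1) _ _ _ limg])
    show "g n holomorphic_on {s. - e n < Im s}"
      unfolding g_def[abs_def]
      by (rule holomorphic_on_compose_gen[OF _ holG, unfolded o_def]) (auto intro!: holomorphic_intros)
    show "cmod (g n s) \<le> 1 / (Im s + e n)" if "- e n < Im s" for s
      using boundG[of "s + \<i> * of_real (e n)"] that by (simp add: g_def)
    show "Im (g n s) \<le> 0" if "- e n < Im s" for s
      using ImG[of "s + \<i> * of_real (e n)"] that by (simp add: g_def)
  qed
  then obtain \<mu> where \<mu>: "\<And>n. real_distribution (\<mu> n)"
      and c\<mu>: "\<And>n z. 0 < Im z \<Longrightarrow> cauchy_transform (\<mu> n) z = g n z"
    by metis
  have "tight \<mu>"
    unfolding tight_def
  proof (intro conjI allI impI \<mu>)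
    \<comment> \<open>The quarters are chosen so that
      \<open>2 * (1 - d / 4)^2 - 1 \<ge> 1 - d\<close>; the cap \<open>d \<le> 1\<close> keeps the
      factors positive.\<close>
    fix d' :: real assume d': "0 < d'"
    define d where "d = min d' 1"
    have d: "0 < d" "d \<le> 1" "d \<le> d'" using d' by (auto simp: d_def)
    have "\<forall>\<^sub>F y in at_top. y * Im (G (\<i> * of_real y)) < - 1 + d / 4"
      by (rule order_tendstoD(2)[OF limG]) (use d in simp)
    \<comment> \<open>Since \<open>e n \<le> 1\<close>, the quotient \<open>y / (y + 1)\<close>
      bounds the loss in passing from \<open>y + e n\<close> to \<open>y\<close> uniformly in
      \<open>n\<close>.\<close>
    moreover have "\<forall>\<^sub>F y in at_top. 1 - d / 4 < y / (y + 1 :: real)"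
      by (rule order_tendstoD(1)[of _ 1]) (real_asymp, use d in simp)
    ultimately have "\<forall>\<^sub>F y in at_top. 0 < y \<and> (\<forall>x\<ge>y. x * Im (G (\<i> * of_real x)) < - 1 + d / 4) \<and> 1 - d / 4 < y / (y + 1 :: real)"
      using eventually_gt_at_top[of 0] by (intro eventually_conj) (simp_all add: eventually_all_ge_at_top)
    then obtain y where y: "0 < y" "\<And>x. y \<le> x \<Longrightarrow> x * Im (G (\<i> * of_real x)) < - 1 + d / 4"
        "1 - d / 4 < y / (y + 1)"
      by (auto simp: eventually_at_top_linorder)
    have "1 - d < measure (\<mu> n) {- y<..y}" for n
    proof -
      interpret \<mu>: real_distribution "\<mu> n" by (rule \<mu>)
      define x where "x = y + e n"
      have x: "y \<le> x" "x \<le> y + 1" "0 < x" using e[of n] y(1) by (auto simp: x_def)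
      have "1 - d / 4 < y / x"
        using x y(1) by (intro less_le_trans[OF y(3)] divide_left_mono) auto
      then have "(1 - d / 4) * (1 - d / 4) < y / x * - (x * Im (G (\<i> * of_real x)))"
        using y(2)[OF x(1)] d by (intro mult_strict_mono) auto
      also have "\<dots> = - (y * Im (cauchy_transform (\<mu> n) (\<i> * of_real y)))"
      proof -
        have "cauchy_transform (\<mu> n) (\<i> * of_real y) = G (\<i> * of_real x)"
          using y(1) by (simp add: c\<mu> g_def x_def distrib_left)
        then show ?thesis using x(3) by simp
      qed
      finally have "2 * ((1 - d / 4) * (1 - d / 4)) - 1 < measure (\<mu> n) {- y<..y}"
        using \<mu>.measure_interval_ge_Im_cauchy_transform[OF y(1)] by linarith
      moreover have "1 - d \<le> 2 * ((1 - d / 4) * (1 - d / 4)) - 1"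
        by (simp add: algebra_simps)
      ultimately show ?thesis by linarith
    qed
    then show "\<exists>a b. a < b \<and> (\<forall>n. 1 - d' < measure (\<mu> n) {a<..b})"
      using y(1) d(3) by (intro exI[of _ "- y"] exI[of _ y]) (auto intro: le_less_trans[of _ "1 - d"])
  qed
  then obtain r M where r: "strict_mono (r :: nat \<Rightarrow> nat)" and M: "real_distribution M"
      and conv: "weak_conv_m (\<mu> \<circ> id \<circ> r) M"
    using tight_imp_convergent_subsubsequence[of \<mu> id] by (auto simp: strict_mono_id)
  \<comment> \<open>The resolvent at a fixed \<open>z\<close> is bounded and continuous in
    \<open>s\<close>, so weak convergence transfers to Cauchy transforms; on the other side
    \<open>g n z\<close> tends to \<open>G z\<close> by continuity.\<close>
  have "cauchy_transform M z = G z" if z: "0 < Im z" for z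
  proof -
    have "(\<lambda>n. \<integral>s. 1 / (z - complex_of_real s) \<partial>(\<mu> \<circ> id \<circ> r) n) \<longlonglongrightarrow> (\<integral>s. 1 / (z - complex_of_real s) \<partial>M)"
      by (rule weak_conv_imp_integral_bdd_continuous_conv[OF _ M conv])
         (use \<mu> cmod_resolvent_le[OF z] minus_real_nonzero[OF z] in \<open>auto intro!: continuous_intros\<close>)
    then have "(\<lambda>n. cauchy_transform (\<mu> (r n)) z) \<longlonglongrightarrow> cauchy_transform M z"
      by (simp add: cauchy_transform_def)
    then have 1: "(\<lambda>n. g (r n) z) \<longlonglongrightarrow> cauchy_transform M z"
      by (simp add: c\<mu>[OF z])
    have "isCont G z"
      using holomorphic_on_imp_continuous_on[OF holG] open_upper_half_plane z
      by (auto simp: continuous_on_eq_continuous_at)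
    moreover have "(\<lambda>n. z + \<i> * of_real (e n)) \<longlonglongrightarrow> z + \<i> * of_real 0"
      unfolding e_def by (intro tendsto_intros) real_asymp
    ultimately have "(\<lambda>n. g n z) \<longlonglongrightarrow> G z"
      unfolding g_def by (intro isCont_tendsto_compose[of z G]) auto
    then have "(\<lambda>n. g (r n) z) \<longlonglongrightarrow> G z"
      using LIMSEQ_subseq_LIMSEQ[OF _ r] by (fastforce simp: o_def)
    with 1 show ?thesis by (rule LIMSEQ_unique)
  qed
  then show ?thesis
    using M by (auto simp: F_transform_def G_def)
qed

subsection \<open>Subordination functions\<close>

text \<open>The representing measure upgrades the limit on the imaginary axis to one that is uniform
  on cones.\<close>

lemma recip_cauchy_nontangential:
  assumes F: "recip_cauchy F" and e: "0 < e"
  shows "\<exists>R>0. \<forall>z. R \<le> Im z \<longrightarrow> cmod z \<le> c * Im z \<longrightarrow> cmod (F z - z) \<le> e * cmod z"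
proof -
  obtain \<mu> where \<mu>: "real_distribution \<mu>" "\<And>z. 0 < Im z \<Longrightarrow> F_transform \<mu> z = F z"
    using recip_cauchy_imp_F_transform[OF F] by auto
  obtain R where R: "R > 0"
      "\<And>z. R \<le> Im z \<Longrightarrow> cmod z \<le> c * Im z \<Longrightarrow> cmod (F_transform \<mu> z - z) \<le> e * cmod z"
    using F_transform_nontangential[OF \<mu>(1) e, of c] by auto
  then have "cmod (F z - z) \<le> e * cmod z" if "R \<le> Im z" "cmod z \<le> c * Im z" for z
    using \<mu>(2)[of z] R(1) R(2)[OF that] that by simp
  then show ?thesis using R(1) by blast
qed

text \<open>The right inverse of the free power in new coordinates. If \<open>f\<close> is a right
  inverse of \<open>F\<close>, then \<open>z + (1 + t) * (f z - z)\<close> belongs to the power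
  \<open>1 + t\<close>, and with \<open>w = f z\<close>, \<open>z = F w\<close> it becomes this
  expression, which makes sense on the whole half-plane. The name refers to the characteristics of
  the complex Burgers equation.\<close>

definition burgers_map :: "(complex \<Rightarrow> complex) \<Rightarrow> real \<Rightarrow> complex \<Rightarrow> complex" where
  "burgers_map F t w = w + of_real t * (w - F w)"

definition subordination :: "(complex \<Rightarrow> complex) \<Rightarrow> real \<Rightarrow> complex \<Rightarrow> complex" where
  "subordination F t z = (THE w. 0 < Im w \<and> burgers_map F t w = z)"

context
  fixes F and t :: real
  assumes F: "recip_cauchy F" and t: "0 \<le> t"
begin

lemma holomorphic_burgers_map: "burgers_map F t holomorphic_on upper_half_plane"
  unfolding burgers_map_def[abs_def] by (intro holomorphic_intros recip_cauchyD(1)[OF F])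

lemma Im_burgers_map_le: "0 < Im w \<Longrightarrow> Im (burgers_map F t w) \<le> Im w"
  using recip_cauchy_Im_ge[OF F, of w] t by (simp add: burgers_map_def mult_nonneg_nonpos)

lemma schwarz_pick_burgers_map:
  assumes v: "0 < Im v" and w: "0 < Im w"
  shows "(cmod ((v - w) - (burgers_map F t v - burgers_map F t w)))\<^sup>2 * (Im v * Im w)
     \<le> (cmod (v - w))\<^sup>2 * ((Im v - Im (burgers_map F t v)) * (Im w - Im (burgers_map F t w)))"
proof -
  have "(\<lambda>w. w - burgers_map F t w) holomorphic_on upper_half_plane"
    by (intro holomorphic_intros holomorphic_burgers_map)
  from schwarz_pick[OF this _ v w] show ?thesis
    using Im_burgers_map_le by (simp add: algebra_simps)
qed

text \<open>Schwarz-Pick for \<open>w - burgers_map F t w\<close> would give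
  \<open>Im v * Im w \<le> (Im v - Im z) * (Im w - Im z)\<close> at a common image \<open>z\<close>;
  \<open>0 < Im z\<close> makes this impossible.\<close>

lemma burgers_map_inject:
  assumes v: "0 < Im v" and w: "0 < Im w" and eq: "burgers_map F t v = burgers_map F t w"
    and pos: "0 < Im (burgers_map F t w)"
  shows "v = w"
proof (rule ccontr)
  assume "v \<noteq> w"
  let ?z = "burgers_map F t w"
  have "Im v * Im w \<le> (Im v - Im ?z) * (Im w - Im ?z)"
    using schwarz_pick_burgers_map[OF v w] eq \<open>v \<noteq> w\<close> by simp
  also have "\<dots> < Im v * Im w"
    using Im_burgers_map_le[OF v] Im_burgers_map_le[OF w] eq pos v w
    by (intro mult_strict_mono') auto
  finally show False by simp
qed

text \<open>Schwarz--Pick makes preimages depend in a Lipschitz way on the image point, which yields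
  closedness of the range.\<close>

lemma burgers_map_lipschitz:
  assumes w: "0 < Im w" and pos: "0 < Im (burgers_map F t w)"
  obtains C where "0 < C"
    "\<And>v. 0 < Im v \<Longrightarrow> 0 < Im (burgers_map F t v) \<Longrightarrow>
       cmod (v - w) \<le> C * cmod (burgers_map F t v - burgers_map F t w)"
proof
  let ?x = "burgers_map F t w"
  \<comment> \<open>The contraction factor: \<open>v - burgers_map F t v\<close> moves by at most
    \<open>q\<close> times the movement of \<open>v\<close> from \<open>w\<close>. It depends on
    \<open>w\<close> alone, and \<open>q < 1\<close> because the image of \<open>w\<close> lies in
    the half-plane.\<close>
  define q where "q = sqrt (1 - Im ?x / Im w)"
  have le1: "0 \<le> 1 - Im ?x / Im w" "1 - Im ?x / Im w < 1"
    using Im_burgers_map_le[OF w] w pos by (auto simp: divide_simps)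
  then have q: "0 \<le> q" "q < 1" and q2: "q\<^sup>2 = 1 - Im ?x / Im w"
    by (auto simp: q_def)
  show "0 < 1 / (1 - q)" using q by simp
  fix v assume v: "0 < Im v" and posv: "0 < Im (burgers_map F t v)"
  let ?z = "burgers_map F t v"
  have "(Im v - Im ?z) * (Im w - Im ?x) \<le> Im v * (Im w - Im ?x)"
    using posv Im_burgers_map_le[OF w] by (intro mult_right_mono) auto
  also have "\<dots> = q\<^sup>2 * (Im v * Im w)"
    using w by (simp add: q2 field_simps)
  finally have "(cmod ((v - w) - (?z - ?x)))\<^sup>2 * (Im v * Im w) \<le> (cmod (v - w))\<^sup>2 * (q\<^sup>2 * (Im v * Im w))"
    using schwarz_pick_burgers_map[OF v w] by (meson mult_left_mono order_trans zero_le_power2)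
  then have "(cmod ((v - w) - (?z - ?x)))\<^sup>2 * (Im v * Im w) \<le> (cmod (v - w) * q)\<^sup>2 * (Im v * Im w)"
    by (simp add: power_mult_distrib)
  then have "(cmod ((v - w) - (?z - ?x)))\<^sup>2 \<le> (cmod (v - w) * q)\<^sup>2"
    using v w by (subst (asm) mult_le_cancel_right_pos) auto
  then have "cmod ((v - w) - (?z - ?x)) \<le> cmod (v - w) * q"
    by (rule power2_le_imp_le) (use q in auto)
  then have "cmod (v - w) - cmod (?z - ?x) \<le> cmod (v - w) * q"
    using norm_triangle_ineq2[of "v - w" "?z - ?x"] by linarith
  then show "cmod (v - w) \<le> 1 / (1 - q) * cmod (?z - ?x)"
    using q by (simp add: field_simps)
qed

text \<open>High on the imaginary axis \<open>F\<close> is close to the identity, hence so is the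
  map. The point serves both as base point for the Lipschitz bound and as witness that the range
  meets the half-plane.\<close>

lemma ex_burgers_map_base: "\<exists>w. 0 < Im w \<and> 0 < Im (burgers_map F t w)"
proof -
  have "((\<lambda>y. 1 + t - t * Re (F (\<i> * of_real y) / (\<i> * of_real y))) \<longlongrightarrow> 1 + t - t * Re 1) at_top"
    by (intro tendsto_intros recip_cauchyD(3)[OF F])
  then have "\<forall>\<^sub>F y in at_top. 0 < 1 + t - t * Re (F (\<i> * of_real y) / (\<i> * of_real y))"
    by (rule order_tendstoD(1)) simp
  then have "\<forall>\<^sub>F y in at_top. 0 < y \<and> 0 < 1 + t - t * Re (F (\<i> * of_real y) / (\<i> * of_real y))"
    by (intro eventually_conj eventually_gt_at_top)
  then obtain y where y: "0 < y" "0 < 1 + t - t * Re (F (\<i> * of_real y) / (\<i> * of_real y))"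
    by (auto simp: eventually_at_top_linorder)
  have "Re (F (\<i> * of_real y) / (\<i> * of_real y)) = Im (F (\<i> * of_real y)) / y"
    using y(1) by (simp add: Re_divide power2_eq_square)
  then have "0 < y * (1 + t - t * (Im (F (\<i> * of_real y)) / y))"
    using y by simp
  then show ?thesis
    using y(1) by (intro exI[of _ "\<i> * of_real y"]) (simp add: burgers_map_def algebra_simps)
qed

text \<open>A connectedness argument: the range within the half-plane is open since an injective
  holomorphic map is open, closed since preimages of a convergent sequence stay bounded, and
  nonempty.\<close>

lemma burgers_map_surj:
  assumes z: "0 < Im z"
  shows "\<exists>w. 0 < Im w \<and> burgers_map F t w = z"
proof -
  let ?\<Phi> = "burgers_map F t"
  define \<Omega> where "\<Omega> = upper_half_plane \<inter> ?\<Phi> -` upper_half_plane"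
  have cont: "continuous_on upper_half_plane ?\<Phi>"
    by (rule holomorphic_on_imp_continuous_on[OF holomorphic_burgers_map])
  have "open \<Omega>"
    unfolding \<Omega>_def by (rule continuous_open_preimage[OF cont open_upper_half_plane open_upper_half_plane])
  moreover have "inj_on ?\<Phi> \<Omega>"
    by (rule inj_onI) (auto simp: \<Omega>_def intro: burgers_map_inject)
  moreover have "?\<Phi> holomorphic_on \<Omega>"
    by (rule holomorphic_on_subset[OF holomorphic_burgers_map]) (auto simp: \<Omega>_def)
  ultimately have "open (?\<Phi> ` \<Omega>)"
    by (intro open_mapping_thm3)
  then have op: "openin (top_of_set upper_half_plane) (?\<Phi> ` \<Omega>)"
    by (subst openin_open_eq[OF open_upper_half_plane]) (auto simp: \<Omega>_def)
  obtain w0 where w0: "0 < Im w0" "0 < Im (?\<Phi> w0)"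
    using ex_burgers_map_base by blast
  obtain C where C: "0 < C" "\<And>v. 0 < Im v \<Longrightarrow> 0 < Im (?\<Phi> v) \<Longrightarrow> cmod (v - w0) \<le> C * cmod (?\<Phi> v - ?\<Phi> w0)"
    using burgers_map_lipschitz[OF w0] by metis
  have cl: "closedin (top_of_set upper_half_plane) (?\<Phi> ` \<Omega>)"
    unfolding closedin_limpt
  proof (intro conjI allI impI)
    show "?\<Phi> ` \<Omega> \<subseteq> upper_half_plane" by (auto simp: \<Omega>_def)
    fix x assume x: "x islimpt ?\<Phi> ` \<Omega> \<and> x \<in> upper_half_plane"
    then obtain X where X: "\<And>n::nat. X n \<in> ?\<Phi> ` \<Omega>" "X \<longlonglongrightarrow> x"
      by (auto simp: islimpt_sequential)
    have "\<forall>n. \<exists>v. 0 < Im v \<and> 0 < Im (?\<Phi> v) \<and> ?\<Phi> v = X n"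
    proof
      fix n
      have "X n \<in> ?\<Phi> ` \<Omega>" by (rule X(1))
      then show "\<exists>v. 0 < Im v \<and> 0 < Im (?\<Phi> v) \<and> ?\<Phi> v = X n"
        by (auto simp: \<Omega>_def)
    qed
    then obtain V where V: "\<And>n. 0 < Im (V n)" "\<And>n. 0 < Im (?\<Phi> (V n))" "\<And>n. ?\<Phi> (V n) = X n"
      by metis
    have "Bseq X" using X(2) by (intro convergent_imp_Bseq) (auto simp: convergent_def)
    then obtain K where K: "\<And>n. cmod (X n) \<le> K" by (auto simp: Bseq_def)
    have "cmod (V n) \<le> C * (K + cmod (?\<Phi> w0)) + cmod w0" for n
    proof -
      have "cmod (V n - w0) \<le> C * cmod (X n - ?\<Phi> w0)"
        using C(2)[OF V(1,2)] V(3) by simp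
      also have "\<dots> \<le> C * (K + cmod (?\<Phi> w0))"
        using C(1) K[of n] norm_triangle_ineq4[of "X n" "?\<Phi> w0"] by (intro mult_left_mono) auto
      finally show ?thesis
        using norm_triangle_ineq2[of "V n" w0] by linarith
    qed
    then have "bounded (range V)" by (auto simp: bounded_iff)
    then obtain l r where l: "strict_mono (r :: nat \<Rightarrow> nat)" "(V \<circ> r) \<longlonglongrightarrow> l"
      using bounded_imp_convergent_subsequence by blast
    have Xr: "(X \<circ> r) \<longlonglongrightarrow> x"
      by (rule LIMSEQ_subseq_LIMSEQ[OF X(2) l(1)])
    \<comment> \<open>The map does not raise imaginary parts, so the limit of preimages cannot reach
      the real axis.\<close>
    have "Im x \<le> Im l"
    proof (rule LIMSEQ_le)
      show "(\<lambda>n. Im ((X \<circ> r) n)) \<longlonglongrightarrow> Im x" "(\<lambda>n. Im ((V \<circ> r) n)) \<longlonglongrightarrow> Im l"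
        by (intro tendsto_Im Xr l(2))+
      show "\<exists>N. \<forall>n\<ge>N. Im ((X \<circ> r) n) \<le> Im ((V \<circ> r) n)"
        using Im_burgers_map_le[OF V(1)] V(3) by auto
    qed
    then have Iml: "0 < Im l" using x by simp
    then have "isCont ?\<Phi> l"
      using cont open_upper_half_plane by (auto simp: continuous_on_eq_continuous_at)
    then have "(\<lambda>n. ?\<Phi> ((V \<circ> r) n)) \<longlonglongrightarrow> ?\<Phi> l"
      using l(2) by (rule isCont_tendsto_compose)
    then have "(X \<circ> r) \<longlonglongrightarrow> ?\<Phi> l"
      by (simp add: V(3) o_def)
    then have "?\<Phi> l = x" using Xr by (rule LIMSEQ_unique)
    then show "x \<in> ?\<Phi> ` \<Omega>"
      using Iml x by (auto simp: \<Omega>_def)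
  qed
  have "?\<Phi> ` \<Omega> = upper_half_plane"
  proof -
    have "w0 \<in> \<Omega>" using w0 by (simp add: \<Omega>_def)
    then have "?\<Phi> ` \<Omega> \<noteq> {}" by blast
    with connected_upper_half_plane[unfolded connected_clopen, rule_format, OF conjI[OF op cl]]
    show ?thesis by metis
  qed
  then show ?thesis
    using z by (force simp: \<Omega>_def)
qed

lemma subordination_props:
  assumes z: "0 < Im z"
  shows "0 < Im (subordination F t z)" "burgers_map F t (subordination F t z) = z"
proof -
  have "\<exists>!w. 0 < Im w \<and> burgers_map F t w = z"
    using burgers_map_surj[OF z] burgers_map_inject z by (metis (no_types))
  from theI'[OF this] show "0 < Im (subordination F t z)" "burgers_map F t (subordination F t z) = z"
    unfolding subordination_def by auto
qed

lemma subordination_eqI: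
  assumes "0 < Im w" "burgers_map F t w = z" "0 < Im z"
  shows "subordination F t z = w"
  using burgers_map_inject[of "subordination F t z" w] subordination_props[OF assms(3)] assms by simp

lemma Im_subordination_ge: "0 < Im z \<Longrightarrow> Im z \<le> Im (subordination F t z)"
  using Im_burgers_map_le subordination_props by metis

lemma holomorphic_subordination: "subordination F t holomorphic_on upper_half_plane"
proof -
  let ?\<Phi> = "burgers_map F t"
  define \<Omega> where "\<Omega> = upper_half_plane \<inter> ?\<Phi> -` upper_half_plane"
  have hol: "?\<Phi> holomorphic_on \<Omega>"
    by (rule holomorphic_on_subset[OF holomorphic_burgers_map]) (auto simp: \<Omega>_def)
  have "open \<Omega>"
    unfolding \<Omega>_def
    by (rule continuous_open_preimage[OF holomorphic_on_imp_continuous_on[OF holomorphic_burgers_map]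
          open_upper_half_plane open_upper_half_plane])
  moreover have "inj_on ?\<Phi> \<Omega>"
    by (rule inj_onI) (auto simp: \<Omega>_def intro: burgers_map_inject)
  ultimately obtain g where g: "g holomorphic_on (?\<Phi> ` \<Omega>)" "\<And>w. w \<in> \<Omega> \<Longrightarrow> g (?\<Phi> w) = w"
    using holomorphic_has_inverse[OF hol] by metis
  have img: "?\<Phi> ` \<Omega> = upper_half_plane"
    using subordination_props by (force simp: \<Omega>_def)
  have "g z = subordination F t z" if "0 < Im z" for z
    using g(2)[of "subordination F t z"] subordination_props[OF that] that by (simp add: \<Omega>_def)
  then show ?thesis
    using g(1) unfolding img by (auto intro: holomorphic_transform)
qed

text \<open>The Lipschitz bound lets \<omega> grow at most linearly in \<open>y\<close>, while its
  imaginary part is at least \<open>y\<close>. So \<omega> stays in a fixed cone, where the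
  nontangential limit of \<open>F\<close> is available.\<close>

lemma subordination_asymp:
  assumes e: "0 < e"
  shows "\<forall>\<^sub>F y in at_top. cmod (F (subordination F t (\<i> * of_real y)) - subordination F t (\<i> * of_real y)) \<le> e * y"
proof -
  let ?\<omega> = "\<lambda>y. subordination F t (\<i> * of_real y)"
  obtain w0 where w0: "0 < Im w0" "0 < Im (burgers_map F t w0)"
    using ex_burgers_map_base by blast
  obtain C where C: "0 < C"
      "\<And>v. 0 < Im v \<Longrightarrow> 0 < Im (burgers_map F t v) \<Longrightarrow> cmod (v - w0) \<le> C * cmod (burgers_map F t v - burgers_map F t w0)"
    using burgers_map_lipschitz[OF w0] by metis
  \<comment> \<open>The Lipschitz bound reads \<open>cmod \<omega> \<le> C * y + A\<close>, and this
    is at most \<open>(C + 1) * y\<close> once \<open>y \<ge> A\<close>.\<close>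
  define A where "A = C * cmod (burgers_map F t w0) + cmod w0"
  define c where "c = C + 1"
  have c: "0 < c" using C by (simp add: c_def)
  have e': "0 < e / c" using c e by simp
  obtain R where R: "R > 0"
      "\<And>z. R \<le> Im z \<Longrightarrow> cmod z \<le> c * Im z \<Longrightarrow> cmod (F z - z) \<le> e / c * cmod z"
    using recip_cauchy_nontangential[OF F e', of c] by auto
  show ?thesis
    using eventually_ge_at_top[of "max R A"]
  proof eventually_elim
    case (elim y)
    have y: "0 < y" using elim R(1) by linarith
    then have p: "0 < Im (\<i> * complex_of_real y)" by simp
    note s = subordination_props[OF p]
    have Im: "y \<le> Im (?\<omega> y)" using Im_subordination_ge[OF p] by simp
    have "cmod (?\<omega> y - w0) \<le> C * cmod (\<i> * of_real y - burgers_map F t w0)"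
      using C(2)[of "?\<omega> y"] s p by simp
    also have "\<dots> \<le> C * (y + cmod (burgers_map F t w0))"
      using C(1) y norm_triangle_ineq4[of "\<i> * of_real y" "burgers_map F t w0"]
      by (intro mult_left_mono) (auto simp: norm_mult)
    finally have "cmod (?\<omega> y) \<le> C * y + A"
      using norm_triangle_ineq2[of "?\<omega> y" w0] by (simp add: A_def algebra_simps)
    also have "\<dots> \<le> c * y" using elim by (simp add: c_def algebra_simps)
    finally have le: "cmod (?\<omega> y) \<le> c * y" .
    also have "\<dots> \<le> c * Im (?\<omega> y)" using Im c by simp
    finally have "cmod (F (?\<omega> y) - ?\<omega> y) \<le> e / c * cmod (?\<omega> y)"
      using R(2)[of "?\<omega> y"] Im elim by simp
    also have "\<dots> \<le> e / c * (c * y)"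
      using le e' by (intro mult_left_mono) auto
    finally show ?case using c by simp
  qed
qed

lemma recip_cauchy_comp_subordination: "recip_cauchy (\<lambda>z. F (subordination F t z))"
proof (rule recip_cauchyI)
  show "(\<lambda>z. F (subordination F t z)) holomorphic_on upper_half_plane"
  proof -
    have "subordination F t ` upper_half_plane \<subseteq> upper_half_plane"
      by (simp add: image_subset_iff subordination_props(1))
    from holomorphic_on_compose_gen[OF holomorphic_subordination recip_cauchyD(1)[OF F] this]
    show ?thesis by (simp only: o_def)
  qed
  show "0 < Im (F (subordination F t z))" if "0 < Im z" for z
    by (rule recip_cauchyD(2)[OF F subordination_props(1)[OF that]])
  show "((\<lambda>y. F (subordination F t (\<i> * of_real y)) / (\<i> * of_real y)) \<longlongrightarrow> 1) at_top"
  proof (rule tendstoI)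
    fix e :: real assume e: "0 < e"
    \<comment> \<open>From the equation for \<omega>,
      \<open>F \<omega> - z = (1 + t) * (F \<omega> - \<omega>)\<close>; dividing by
      \<open>1 + t\<close> absorbs this factor and the half leaves room for a strict
      inequality.\<close>
    define d where "d = e / 2 / (1 + t)"
    have d: "0 < d" using e t by (simp add: d_def)
    show "\<forall>\<^sub>F y in at_top. dist (F (subordination F t (\<i> * of_real y)) / (\<i> * of_real y)) 1 < e"
      using subordination_asymp[OF d] eventually_gt_at_top[of 0]
    proof eventually_elim
      case (elim y)
      let ?z = "\<i> * complex_of_real y"
      let ?w = "subordination F t ?z"
      have p: "0 < Im ?z" using elim by simp
      have "F ?w - ?z = of_real (1 + t) * (F ?w - ?w)"
      proof -
        have "a - (b + of_real t * (b - a)) = of_real (1 + t) * (a - b)" for a b :: complex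
          by (simp add: algebra_simps)
        from this[of "F ?w" ?w] show ?thesis
          using subordination_props(2)[OF p] by (simp only: burgers_map_def)
      qed
      then have "cmod (F ?w - ?z) \<le> (1 + t) * (d * y)"
        using elim(1) t by (simp only: norm_mult norm_of_real) (simp add: mult_left_mono)
      also have "\<dots> = e / 2 * y"
      proof -
        have "(1 + t) * d = e / 2"
          using t d_def unfolding eq_divide_eq by (simp add: mult.commute)
        then show ?thesis by (simp only: mult.assoc[symmetric])
      qed
      finally have "cmod (F ?w - ?z) \<le> e / 2 * y" .
      also have "\<dots> < e * y" using e elim(2) by simp
      finally have "cmod (F ?w - ?z) / cmod ?z < e"
        using elim(2) by (simp only: norm_mult norm_ii norm_of_real) (simp add: pos_divide_less_eq)
      moreover have "F ?w / ?z - 1 = (F ?w - ?z) / ?z"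
        using elim(2) by (simp add: diff_divide_distrib)
      ultimately show ?case
        by (simp only: dist_norm norm_divide)
    qed
  qed
qed

end

subsection \<open>Right inverses on truncated cones\<close>

lemma truncated_cone_eq:
  "truncated_cone \<alpha> \<beta> = {z. inner \<i> z > 0} \<inter> {z. inner (Complex 1 (- \<alpha>)) z < 0}
     \<inter> {z. inner (Complex (- 1) (- \<alpha>)) z < 0} \<inter> {z. inner \<i> z > \<beta>}"
  by (auto simp: truncated_cone_def inner_complex_def)

lemma open_truncated_cone: "open (truncated_cone \<alpha> \<beta>)"
  unfolding truncated_cone_eq by (intro open_Int open_halfspace_lt open_halfspace_gt)

lemma connected_truncated_cone: "connected (truncated_cone \<alpha> \<beta>)"
  unfolding truncated_cone_eq
  by (intro convex_connected convex_Int convex_halfspace_lt convex_halfspace_gt)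

lemma truncated_cone_nonempty: "0 < \<alpha> \<Longrightarrow> truncated_cone \<alpha> \<beta> \<noteq> {}"
proof -
  assume "0 < \<alpha>"
  then have "\<i> * of_real (max 0 \<beta> + 1) \<in> truncated_cone \<alpha> \<beta>"
    by (auto simp: truncated_cone_def)
  then show ?thesis by blast
qed

lemma truncated_cone_mono: "\<alpha>' \<le> \<alpha> \<Longrightarrow> \<beta> \<le> \<beta>' \<Longrightarrow> truncated_cone \<alpha>' \<beta>' \<subseteq> truncated_cone \<alpha> \<beta>"
proof
  fix z assume a: "\<alpha>' \<le> \<alpha>" "\<beta> \<le> \<beta>'" "z \<in> truncated_cone \<alpha>' \<beta>'"
  then have "\<alpha>' * Im z \<le> \<alpha> * Im z"
    by (intro mult_right_mono) (auto simp: truncated_cone_def)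
  then show "z \<in> truncated_cone \<alpha> \<beta>"
    using a by (auto simp: truncated_cone_def intro: less_le_trans)
qed

lemma cmod_truncated_cone_le: "z \<in> truncated_cone \<alpha> \<beta> \<Longrightarrow> cmod z \<le> (1 + \<alpha>) * Im z"
  using cmod_le[of z] by (auto simp: truncated_cone_def algebra_simps)

lemma truncated_coneD: "z \<in> truncated_cone \<alpha> \<beta> \<Longrightarrow> 0 < Im z" "z \<in> truncated_cone \<alpha> \<beta> \<Longrightarrow> \<beta> < Im z"
  by (auto simp: truncated_cone_def)

lemma is_F_right_inverse_iff:
  "is_F_right_inverse \<mu> \<alpha> \<beta> f \<longleftrightarrow> f holomorphic_on truncated_cone \<alpha> \<beta> \<and>
     (\<forall>z\<in>truncated_cone \<alpha> \<beta>. 0 < Im (f z) \<and> F_transform \<mu> (f z) = z) \<and>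
     (\<forall>e>0. \<exists>b. \<forall>z\<in>truncated_cone \<alpha> \<beta>. b \<le> cmod z \<longrightarrow> cmod (f z - z) < e * cmod z)"
proof -
  have "dist (f z / z) 1 < e \<longleftrightarrow> cmod (f z - z) < e * cmod z" if "z \<in> truncated_cone \<alpha> \<beta>" for z e
  proof -
    have "z \<noteq> 0" using truncated_coneD(1)[OF that] by auto
    then have "f z / z - 1 = (f z - z) / z" by (simp add: diff_divide_distrib)
    then show ?thesis using \<open>z \<noteq> 0\<close> by (simp add: dist_norm norm_divide divide_simps)
  qed
  then have "((\<lambda>z. f z / z) \<longlongrightarrow> 1) (inf at_infinity (principal (truncated_cone \<alpha> \<beta>))) \<longleftrightarrow>
     (\<forall>e>0. \<exists>b. \<forall>z\<in>truncated_cone \<alpha> \<beta>. b \<le> cmod z \<longrightarrow> cmod (f z - z) < e * cmod z)"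
    unfolding tendsto_iff eventually_inf_principal eventually_at_infinity
    by (intro all_cong ex_cong1) auto
  then show ?thesis
    unfolding is_F_right_inverse_def by (auto simp: image_subset_iff)
qed

lemma is_F_right_inverse_mono:
  assumes "is_F_right_inverse \<mu> \<alpha> \<beta> f" "\<alpha>' \<le> \<alpha>" "\<beta> \<le> \<beta>'"
  shows "is_F_right_inverse \<mu> \<alpha>' \<beta>' f"
  unfolding is_F_right_inverse_iff
proof (intro conjI ballI allI impI)
  note sub = truncated_cone_mono[OF assms(2,3)]
  note f = assms(1)[unfolded is_F_right_inverse_iff]
  show "f holomorphic_on truncated_cone \<alpha>' \<beta>'"
    using f sub by (blast intro: holomorphic_on_subset)
  show "0 < Im (f z)" "F_transform \<mu> (f z) = z" if "z \<in> truncated_cone \<alpha>' \<beta>'" for z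
    using f sub that by blast+
  fix e :: real assume "0 < e"
  then obtain b where "\<forall>z\<in>truncated_cone \<alpha> \<beta>. b \<le> cmod z \<longrightarrow> cmod (f z - z) < e * cmod z"
    using f by blast
  then show "\<exists>b. \<forall>z\<in>truncated_cone \<alpha>' \<beta>'. b \<le> cmod z \<longrightarrow> cmod (f z - z) < e * cmod z"
    using sub by blast
qed

section \<open>Existence and uniqueness of right inverses\<close>

text \<open>\<open>F\<close> need not be injective, but preimages close to \<open>z\<close> are
  unique. Schwarz-Pick for \<open>F w - w\<close> gives
  \<open>Im v * Im w \<le> (Im z - Im v) * (Im z - Im w)\<close>, while both preimages lie above
  height \<open>Im z / 2\<close>.\<close>

lemma F_transform_inject_near:
  fixes v w z :: complex
  assumes \<mu>: "real_distribution \<mu>"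
    and eq: "F_transform \<mu> v = z" "F_transform \<mu> w = z"
    and z: "0 < Im z" and near: "cmod (v - z) < Im z / 2" "cmod (w - z) < Im z / 2"
  shows "v = w"
proof (rule ccontr)
  assume ne: "v \<noteq> w"
  let ?K = "\<lambda>w. F_transform \<mu> w - w"
  note F = recip_cauchy_F_transform[OF \<mu>]
  have Im: "Im z / 2 < Im u" if "cmod (u - z) < Im z / 2" for u
    using abs_Im_le_cmod[of "u - z"] that by (simp add: abs_if field_simps split: if_splits)
  have v: "Im z / 2 < Im v" and w: "Im z / 2 < Im w"
    using Im near by blast+
  have "(cmod (?K v - ?K w))\<^sup>2 * (Im v * Im w) \<le> (cmod (v - w))\<^sup>2 * (Im (?K v) * Im (?K w))"
    by (rule schwarz_pick) (use z v w recip_cauchy_Im_ge[OF F] recip_cauchyD(1)[OF F] in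
        \<open>auto intro!: holomorphic_intros\<close>)
  then have "Im v * Im w \<le> (Im z - Im v) * (Im z - Im w)"
    using eq ne by (simp add: norm_minus_commute)
  also have "\<dots> < Im z / 2 * (Im z / 2)"
    using recip_cauchy_Im_ge[OF F, of v] recip_cauchy_Im_ge[OF F, of w] eq v w z
    by (intro mult_strict_mono') auto
  also have "\<dots> < Im v * Im w"
    using v w z by (intro mult_strict_mono') auto
  finally show False .
qed

text \<open>Solutions of \<open>F w = z\<close> are fixed points of \<open>w - F w + z\<close>,
  found by Brouwer's theorem in a ball around \<open>z\<close>.
  \<open>F_transform_inject_near\<close> makes them unique, and inverting an injective holomorphic
  function makes them holomorphic in \<open>z\<close>.\<close>

lemma ex_F_right_inverse:
  assumes \<mu>: "real_distribution \<mu>" and \<alpha>: "0 < \<alpha>"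
  shows "\<exists>\<beta>>0. \<exists>f. is_F_right_inverse \<mu> \<alpha> \<beta> f"
proof -
  let ?F = "F_transform \<mu>"
  note F = recip_cauchy_F_transform[OF \<mu>]
  \<comment> \<open>\<open>c\<close> is large enough that the disc of radius \<open>Im z / 2\<close>
    about a point of the cone lies in the wider cone \<open>cmod w \<le> c * Im w\<close>.
    \<open>r\<close> makes the ball of radius \<open>r * cmod z\<close> fit into height
    \<open>Im z / 4\<close>; with the accuracy \<open>r / 2\<close> and
    \<open>cmod w \<le> 2 * cmod z\<close> the Brouwer map sends that ball to itself.\<close>
  define c where "c = 3 + 2 * \<alpha>"
  define r where "r = 1 / (4 * (1 + \<alpha>))"
  have r: "0 < r" using \<alpha> by (simp add: r_def)
  have near: "Im z / 2 < Im w" "cmod w \<le> c * Im w" "cmod w \<le> 2 * cmod z"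
    if "cmod (w - z) < Im z / 2" "z \<in> truncated_cone \<alpha> \<beta>" for w z \<beta>
  proof -
    show 1: "Im z / 2 < Im w"
      using abs_Im_le_cmod[of "w - z"] that(1) by (simp add: abs_if split: if_splits)
    have w: "cmod w < cmod z + Im z / 2"
      using norm_triangle_ineq2[of w z] that(1) by linarith
    have "cmod z + Im z / 2 \<le> (1 + \<alpha>) * Im z + Im z / 2"
      using cmod_truncated_cone_le[OF that(2)] by simp
    also have "\<dots> = c * (Im z / 2)" by (simp add: c_def algebra_simps)
    also have "\<dots> \<le> c * Im w" using 1 \<alpha> by (intro mult_left_mono) (auto simp: c_def)
    finally show "cmod w \<le> c * Im w" using w by linarith
    show "cmod w \<le> 2 * cmod z"
      using w abs_Im_le_cmod[of z] truncated_coneD(1)[OF that(2)] by linarith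
  qed
  have r2: "0 < r / 2" using r by simp
  obtain R where R: "R > 0" "\<And>z. R \<le> Im z \<Longrightarrow> cmod z \<le> c * Im z \<Longrightarrow> cmod (?F z - z) \<le> r / 2 * cmod z"
    using F_transform_nontangential[OF \<mu> r2, of c] by auto
  define \<Gamma> where "\<Gamma> = truncated_cone \<alpha> (2 * R)"
  \<comment> \<open>The points close to their own image; the last condition is phrased as a
    continuous preimage so that openness is immediate.\<close>
  define T where "T = upper_half_plane \<inter> ?F -` \<Gamma> \<inter>
      (upper_half_plane \<inter> (\<lambda>w. Im (?F w) / 2 - cmod (w - ?F w)) -` {0<..})"
  have contF: "continuous_on upper_half_plane ?F"
    by (rule holomorphic_on_imp_continuous_on[OF recip_cauchyD(1)[OF F]])
  have T: "w \<in> T \<longleftrightarrow> 0 < Im w \<and> ?F w \<in> \<Gamma> \<and> cmod (w - ?F w) < Im (?F w) / 2" for w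
    by (auto simp: T_def)
  have "open T"
    unfolding T_def \<Gamma>_def
    by (intro open_Int continuous_open_preimage open_upper_half_plane open_truncated_cone
        open_greaterThan continuous_on_diff continuous_on_divide continuous_on_Im continuous_on_norm
        continuous_on_id continuous_on_const contF) simp
  moreover have "inj_on ?F T"
    by (rule inj_onI, rule F_transform_inject_near[OF \<mu> _ refl]) 
       (auto simp: T \<Gamma>_def dest: truncated_coneD)
  moreover have holF: "?F holomorphic_on T"
    by (rule holomorphic_on_subset[OF recip_cauchyD(1)[OF F]]) (auto simp: T)
  ultimately obtain f where f: "f holomorphic_on (?F ` T)" "\<And>w. w \<in> T \<Longrightarrow> f (?F w) = w"
    using holomorphic_has_inverse[OF holF] by metis
  have ex: "\<exists>w\<in>T. ?F w = z" if z: "z \<in> \<Gamma>" for z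
  proof -
    have Imz: "0 < Im z" "2 * R < Im z" using z truncated_coneD by (auto simp: \<Gamma>_def)
    have z0: "0 < cmod z" using Imz by auto
    have small: "cmod (w - z) < Im z / 2" if "w \<in> cball z (r * cmod z)" for w
    proof -
      have "cmod (w - z) \<le> r * cmod z" using that by (simp add: dist_norm norm_minus_commute)
      also have "\<dots> \<le> r * ((1 + \<alpha>) * Im z)"
        using cmod_truncated_cone_le[of z \<alpha> "2 * R"] z r by (intro mult_left_mono) (auto simp: \<Gamma>_def)
      also have "\<dots> = Im z / 4"
      proof -
        have "4 + 4 * \<alpha> \<noteq> 0" using \<alpha> by linarith
        then show ?thesis by (simp add: r_def field_simps)
      qed
      finally show ?thesis using Imz by simp
    qed
    have zc: "z \<in> truncated_cone \<alpha> (2 * R)" using z by (simp add: \<Gamma>_def)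
    have pos: "Im z / 2 < Im w" if "w \<in> cball z (r * cmod z)" for w
      by (rule near(1)[OF small[OF that] zc])
    obtain w where w: "w \<in> cball z (r * cmod z)" "w - ?F w + z = w"
    proof (rule brouwer_ball[of "r * cmod z" z "\<lambda>w. w - ?F w + z"])
      show "0 < r * cmod z" using r z0 by simp
      show "continuous_on (cball z (r * cmod z)) (\<lambda>w. w - ?F w + z)"
        using pos Imz(1) by (intro continuous_intros continuous_on_subset[OF contF]) (force)
      show "(\<lambda>w. w - ?F w + z) \<in> cball z (r * cmod z) \<rightarrow> cball z (r * cmod z)"
      proof
        fix w assume w: "w \<in> cball z (r * cmod z)"
        have "R \<le> Im w" using pos[OF w] Imz by linarith
        then have "cmod (?F w - w) \<le> r / 2 * cmod w"
          by (rule R(2)[OF _ near(2)[OF small[OF w] zc]])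
        also have "\<dots> \<le> r / 2 * (2 * cmod z)"
          using near(3)[OF small[OF w] zc] r by (intro mult_left_mono) auto
        finally show "w - ?F w + z \<in> cball z (r * cmod z)"
          by (simp add: dist_norm)
      qed
    qed
    then have "?F w = z" by simp
    moreover have "w \<in> T"
      using calculation pos[OF w(1)] small[OF w(1)] z Imz by (auto simp: T)
    ultimately show ?thesis by blast
  qed
  have fz: "f z \<in> T" "?F (f z) = z" if "z \<in> \<Gamma>" for z
    using ex[OF that] f(2) by auto
  have img: "?F ` T = \<Gamma>" using ex by (force simp: T)
  have "is_F_right_inverse \<mu> \<alpha> (2 * R) f"
    unfolding is_F_right_inverse_iff \<Gamma>_def[symmetric]
  proof (intro conjI ballI allI impI)
    show "f holomorphic_on \<Gamma>" using f(1) img by simp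
    show "0 < Im (f z)" "?F (f z) = z" if "z \<in> \<Gamma>" for z
      using fz[OF that] by (auto simp: T)
    fix e :: real assume "0 < e"
    then have e: "0 < e / 4" by simp
    obtain R' where R': "R' > 0" "\<And>z. R' \<le> Im z \<Longrightarrow> cmod z \<le> c * Im z \<Longrightarrow> cmod (?F z - z) \<le> e / 4 * cmod z"
      using F_transform_nontangential[OF \<mu> e, of c] by auto
    \<comment> \<open>The threshold forces \<open>Im z \<ge> 2 * R'\<close>, hence
      \<open>Im (f z) \<ge> R'\<close>.\<close>
    have "cmod (f z - z) < e * cmod z" if z: "z \<in> \<Gamma>" "2 * R' * (1 + \<alpha>) \<le> cmod z" for z
    proof -
      have zc: "z \<in> truncated_cone \<alpha> (2 * R)" using z by (simp add: \<Gamma>_def)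
      have "2 * R' * (1 + \<alpha>) \<le> Im z * (1 + \<alpha>)"
        using z(2) cmod_truncated_cone_le[OF zc] by (simp add: mult.commute)
      then have "2 * R' \<le> Im z" using \<alpha> by (subst (asm) mult_le_cancel_right_pos) auto
      moreover have "cmod (f z - z) < Im z / 2" using fz[OF z(1)] by (auto simp: T)
      note n = near[OF this zc]
      ultimately have "cmod (?F (f z) - f z) \<le> e / 4 * cmod (f z)"
        using R'(2) n by auto
      also have "\<dots> \<le> e / 4 * (2 * cmod z)"
        using n(3) e by (intro mult_left_mono) auto
      also have "\<dots> < e * cmod z"
        using e truncated_coneD(1)[OF zc] by auto
      finally show ?thesis using fz(2)[OF z(1)] by (simp add: norm_minus_commute)
    qed
    then show "\<exists>b. \<forall>z\<in>\<Gamma>. b \<le> cmod z \<longrightarrow> cmod (f z - z) < e * cmod z" by blast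
  qed
  then show ?thesis using R(1) by (intro exI[of _ "2 * R"]) auto
qed

lemma F_right_inverse_near:
  assumes f: "is_F_right_inverse \<mu> \<alpha> \<beta> f" and \<alpha>: "0 < \<alpha>" and e: "0 < e"
  obtains b where "\<beta> \<le> b" "\<And>z. z \<in> truncated_cone \<alpha> b \<Longrightarrow> cmod (f z - z) < e * Im z"
proof -
  have e': "0 < e / (1 + \<alpha>)" using e \<alpha> by simp
  obtain b where b: "\<And>z. z \<in> truncated_cone \<alpha> \<beta> \<Longrightarrow> b \<le> cmod z \<Longrightarrow> cmod (f z - z) < e / (1 + \<alpha>) * cmod z"
    using f e' unfolding is_F_right_inverse_iff by blast
  have "cmod (f z - z) < e * Im z" if z: "z \<in> truncated_cone \<alpha> (max b \<beta>)" for z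
  proof -
    have "z \<in> truncated_cone \<alpha> \<beta>" using truncated_cone_mono[of \<alpha> \<alpha> \<beta> "max b \<beta>"] z by auto
    moreover have "b \<le> cmod z" using truncated_coneD(2)[OF z] abs_Im_le_cmod[of z] by linarith
    ultimately have "cmod (f z - z) < e / (1 + \<alpha>) * cmod z" by (rule b)
    also have "\<dots> \<le> e / (1 + \<alpha>) * ((1 + \<alpha>) * Im z)"
      using cmod_truncated_cone_le[OF z] e' by (intro mult_left_mono) auto
    finally show ?thesis using \<alpha> by simp
  qed
  then show ?thesis by (intro that[of "max b \<beta>"]) auto
qed

text \<open>By the normalisation at infinity both inverses are near \<open>z\<close> far out in the
  cone, where preimages are unique; the identity theorem extends equality to the whole cone.\<close>

lemma F_right_inverse_unique:
  assumes \<mu>: "real_distribution \<mu>" and \<alpha>: "0 < \<alpha>"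
    and f: "is_F_right_inverse \<mu> \<alpha> \<beta> f" and g: "is_F_right_inverse \<mu> \<alpha> \<beta> g"
    and z: "z \<in> truncated_cone \<alpha> \<beta>"
  shows "f z = g z"
proof -
  obtain b where b: "\<beta> \<le> b" "\<And>z. z \<in> truncated_cone \<alpha> b \<Longrightarrow> cmod (f z - z) < 1 / 2 * Im z"
    using F_right_inverse_near[OF f \<alpha>, of "1/2"] by auto
  obtain b' where b': "\<beta> \<le> b'" "\<And>z. z \<in> truncated_cone \<alpha> b' \<Longrightarrow> cmod (g z - z) < 1 / 2 * Im z"
    using F_right_inverse_near[OF g \<alpha>, of "1/2"] by auto
  have sub: "truncated_cone \<alpha> (max b b') \<subseteq> truncated_cone \<alpha> b"
    "truncated_cone \<alpha> (max b b') \<subseteq> truncated_cone \<alpha> b'"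
    "truncated_cone \<alpha> (max b b') \<subseteq> truncated_cone \<alpha> \<beta>"
    using b(1) b'(1) by (intro truncated_cone_mono; simp)+
  show ?thesis
  proof (rule analytic_continuation_open[of "truncated_cone \<alpha> (max b b')" "truncated_cone \<alpha> \<beta>" f g])
    show "f w = g w" if "w \<in> truncated_cone \<alpha> (max b b')" for w
      by (rule F_transform_inject_near[OF \<mu>, of _ w])
         (use that sub f g b b' truncated_coneD(1)[OF that] in \<open>auto simp: is_F_right_inverse_iff\<close>)
  qed (use f g z \<alpha> sub in \<open>auto simp: is_F_right_inverse_iff truncated_cone_nonempty
      intro: open_truncated_cone connected_truncated_cone\<close>)
qed

text \<open>The image of the cone under \<open>f\<close> is open, as \<open>f\<close> is injective,
  and both transforms invert \<open>f\<close> there. The identity theorem spreads their equality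
  over the half-plane.\<close>

lemma F_right_inverse_determines_measure:
  assumes \<mu>: "real_distribution \<mu>" and \<nu>: "real_distribution \<nu>" and \<alpha>: "0 < \<alpha>"
    and f: "is_F_right_inverse \<mu> \<alpha> \<beta> f" "is_F_right_inverse \<nu> \<alpha> \<beta> f"
  shows "\<mu> = \<nu>"
proof (rule F_transform_inject[OF \<mu> \<nu>])
  fix z :: complex assume z: "0 < Im z"
  let ?\<Gamma> = "truncated_cone \<alpha> \<beta>"
  have hol: "f holomorphic_on ?\<Gamma>" and F: "\<And>z. z \<in> ?\<Gamma> \<Longrightarrow> F_transform \<mu> (f z) = z"
      "\<And>z. z \<in> ?\<Gamma> \<Longrightarrow> F_transform \<nu> (f z) = z" "\<And>z. z \<in> ?\<Gamma> \<Longrightarrow> 0 < Im (f z)"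
    using f by (auto simp: is_F_right_inverse_iff)
  have "inj_on f ?\<Gamma>" using F(1) by (rule inj_on_inverseI)
  then have op: "open (f ` ?\<Gamma>)"
    by (rule open_mapping_thm3[OF hol open_truncated_cone])
  show "F_transform \<mu> z = F_transform \<nu> z"
    by (rule analytic_continuation_open[OF op open_upper_half_plane _ connected_upper_half_plane])
       (use F z truncated_cone_nonempty[OF \<alpha>] recip_cauchyD(1)[OF recip_cauchy_F_transform] \<mu> \<nu> in auto)
qed

lemma is_V_transform_mono:
  "is_V_transform \<mu> \<alpha> \<beta> v \<Longrightarrow> \<alpha>' \<le> \<alpha> \<Longrightarrow> \<beta> \<le> \<beta>' \<Longrightarrow> is_V_transform \<mu> \<alpha>' \<beta>' v"
  unfolding is_V_transform_def using is_F_right_inverse_mono truncated_cone_mono by (meson subsetD)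

lemma V_transform_unique:
  assumes "real_distribution \<mu>" "0 < \<alpha>" "is_V_transform \<mu> \<alpha> \<beta> u" "is_V_transform \<mu> \<alpha> \<beta> v"
    "z \<in> truncated_cone \<alpha> \<beta>"
  shows "u z = v z"
proof -
  obtain f g where "is_F_right_inverse \<mu> \<alpha> \<beta> f" "is_F_right_inverse \<mu> \<alpha> \<beta> g"
    "u z = f z - z" "v z = g z - z"
    using assms(3-5) unfolding is_V_transform_def by blast
  then show ?thesis
    using F_right_inverse_unique[OF assms(1,2)] assms(5) by simp
qed

lemma V_transform_determines_measure:
  assumes \<mu>: "real_distribution \<mu>" and \<nu>: "real_distribution \<nu>" and \<alpha>: "0 < \<alpha>"
    and "is_V_transform \<mu> \<alpha> \<beta> u" "is_V_transform \<nu> \<alpha> \<beta> v"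
    and eq: "\<And>z. z \<in> truncated_cone \<alpha> \<beta> \<Longrightarrow> u z = v z"
  shows "\<mu> = \<nu>"
proof -
  obtain f g where f: "is_F_right_inverse \<mu> \<alpha> \<beta> f" "\<And>z. z \<in> truncated_cone \<alpha> \<beta> \<Longrightarrow> u z = f z - z"
    and g: "is_F_right_inverse \<nu> \<alpha> \<beta> g" "\<And>z. z \<in> truncated_cone \<alpha> \<beta> \<Longrightarrow> v z = g z - z"
    using assms(4,5) unfolding is_V_transform_def by blast
  have fg: "f z = g z" if "z \<in> truncated_cone \<alpha> \<beta>" for z
    using f(2)[OF that] g(2)[OF that] eq[OF that] by simp
  have "is_F_right_inverse \<nu> \<alpha> \<beta> f"
    using g(1) fg unfolding is_F_right_inverse_iff by (simp add: holomorphic_cong[of _ _ f g])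
  with f(1) show ?thesis
    by (rule F_right_inverse_determines_measure[OF \<mu> \<nu> \<alpha>])
qed

subsection \<open>Convolution powers\<close>

lemma boolean_power_props:
  assumes \<mu>: "real_distribution \<mu>" and t: "0 \<le> t"
  shows "real_distribution (boolean_power \<mu> t)"
    and "0 < Im z \<Longrightarrow> F_transform (boolean_power \<mu> t) z = of_real t * F_transform \<mu> z + (1 - of_real t) * z"
proof -
  let ?F = "\<lambda>z. of_real t * F_transform \<mu> z + (1 - of_real t) * z"
  note F = recip_cauchy_F_transform[OF \<mu>]
  have "recip_cauchy ?F"
  proof (rule recip_cauchyI)
    show "?F holomorphic_on upper_half_plane"
      by (intro holomorphic_intros recip_cauchyD(1)[OF F])
    show "0 < Im (?F z)" if "0 < Im z" for z
    proof -
      \<comment> \<open>For \<open>t > 1\<close> the coefficient of \<open>z\<close> is negative;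
        \<open>Im z \<le> Im (F z)\<close> still gives an imaginary part of at least
        \<open>Im z\<close>.\<close>
      have "t * Im z \<le> t * Im (F_transform \<mu> z)"
        using recip_cauchy_Im_ge[OF F that] t by (rule mult_left_mono)
      then show ?thesis using that by (simp add: algebra_simps)
    qed
    have "((\<lambda>y. of_real t * (F_transform \<mu> (\<i> * of_real y) / (\<i> * of_real y)) + (1 - of_real t))
        \<longlongrightarrow> of_real t * 1 + (1 - of_real t)) at_top"
      by (intro tendsto_intros recip_cauchyD(3)[OF F])
    moreover have "\<forall>\<^sub>F y in at_top. of_real t * (F_transform \<mu> (\<i> * of_real y) / (\<i> * of_real y)) + (1 - of_real t)
        = ?F (\<i> * of_real y) / (\<i> * of_real y)"
      using eventually_gt_at_top[of 0] by eventually_elim (simp add: add_divide_distrib)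
    ultimately show "((\<lambda>y. ?F (\<i> * of_real y) / (\<i> * of_real y)) \<longlongrightarrow> 1) at_top"
      using Lim_transform_eventually by fastforce
  qed
  then obtain \<rho> where \<rho>: "real_distribution \<rho>" "\<And>z. 0 < Im z \<Longrightarrow> F_transform \<rho> z = ?F z"
    using recip_cauchy_imp_F_transform by blast
  have "boolean_power \<mu> t = \<rho>"
    unfolding boolean_power_def
  proof (rule the_equality)
    show "\<rho> \<in> borel_prob_measures \<and> (\<forall>z\<in>upper_half_plane. F_transform \<rho> z = ?F z)"
      using \<rho> by (simp add: borel_prob_measures_def)
    show "\<sigma> = \<rho>" if "\<sigma> \<in> borel_prob_measures \<and> (\<forall>z\<in>upper_half_plane. F_transform \<sigma> z = ?F z)" for \<sigma>
      by (rule F_transform_inject) (use that \<rho> in \<open>simp_all add: borel_prob_measures_def\<close>)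
  qed
  with \<rho> show "real_distribution (boolean_power \<mu> t)"
    "0 < Im z \<Longrightarrow> F_transform (boolean_power \<mu> t) z = ?F z"
    by simp_all
qed

text \<open>A competitor in the description brings its own cone and its own \<open>V\<close>. Both
  sets of data are restricted to the intersection of the cones, where \<open>V\<close> of \<mu> is
  unique.\<close>

lemma free_power_eqI:
  assumes \<mu>: "real_distribution \<mu>" and \<rho>: "real_distribution \<rho>" and pos: "0 < \<alpha>" "0 < \<beta>"
    and V: "is_V_transform \<mu> \<alpha> \<beta> u" "is_V_transform \<rho> \<alpha> \<beta> w"
    and eq: "\<And>z. z \<in> truncated_cone \<alpha> \<beta> \<Longrightarrow> w z = of_real t * u z"
  shows "free_power \<mu> t = \<rho>"
  unfolding free_power_def
proof (rule the_equality)
  show "\<rho> \<in> borel_prob_measures \<and> (\<exists>\<alpha>>0. \<exists>\<beta>>0. \<exists>u w. is_V_transform \<mu> \<alpha> \<beta> u \<and>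
      is_V_transform \<rho> \<alpha> \<beta> w \<and> (\<forall>z\<in>truncated_cone \<alpha> \<beta>. w z = of_real t * u z))"
    using assms unfolding borel_prob_measures_def by blast
next
  fix \<sigma> assume a: "\<sigma> \<in> borel_prob_measures \<and> (\<exists>\<alpha>>0. \<exists>\<beta>>0. \<exists>u w. is_V_transform \<mu> \<alpha> \<beta> u \<and>
      is_V_transform \<sigma> \<alpha> \<beta> w \<and> (\<forall>z\<in>truncated_cone \<alpha> \<beta>. w z = of_real t * u z))"
  then obtain \<alpha>' \<beta>' u' w' where pos': "0 < \<alpha>'" "0 < \<beta>'"
      and V': "is_V_transform \<mu> \<alpha>' \<beta>' u'" "is_V_transform \<sigma> \<alpha>' \<beta>' w'"
      and eq': "\<And>z. z \<in> truncated_cone \<alpha>' \<beta>' \<Longrightarrow> w' z = of_real t * u' z"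
    by blast
  define a b where "a = min \<alpha> \<alpha>'" and "b = max \<beta> \<beta>'"
  have a: "0 < a" "a \<le> \<alpha>" "a \<le> \<alpha>'" "\<beta> \<le> b" "\<beta>' \<le> b" and \<sigma>: "real_distribution \<sigma>"
    using pos pos' a by (auto simp: a_def b_def borel_prob_measures_def)
  show "\<sigma> = \<rho>"
  proof (rule V_transform_determines_measure[OF \<sigma> \<rho> a(1)])
    show "is_V_transform \<sigma> a b w'" "is_V_transform \<rho> a b w"
      using V(2) V'(2) a by (auto intro: is_V_transform_mono)
    fix z assume z: "z \<in> truncated_cone a b"
    have "u z = u' z"
      using V(1) V'(1) a z by (intro V_transform_unique[OF \<mu> a(1)]) (auto intro: is_V_transform_mono)
    moreover have "z \<in> truncated_cone \<alpha> \<beta>" "z \<in> truncated_cone \<alpha>' \<beta>'"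
      using z truncated_cone_mono[OF a(2,4)] truncated_cone_mono[OF a(3,5)] by blast+
    ultimately show "w' z = w z"
      using eq[of z] eq'[of z] by simp
  qed
qed

lemma free_conv_eqI:
  assumes \<mu>: "real_distribution \<mu>" and \<nu>: "real_distribution \<nu>" and \<rho>: "real_distribution \<rho>"
    and pos: "0 < \<alpha>" "0 < \<beta>"
    and V: "is_V_transform \<mu> \<alpha> \<beta> u" "is_V_transform \<nu> \<alpha> \<beta> v" "is_V_transform \<rho> \<alpha> \<beta> w"
    and eq: "\<And>z. z \<in> truncated_cone \<alpha> \<beta> \<Longrightarrow> w z = u z + v z"
  shows "free_conv \<mu> \<nu> = \<rho>"
  unfolding free_conv_def
proof (rule the_equality)
  show "\<rho> \<in> borel_prob_measures \<and> (\<exists>\<alpha>>0. \<exists>\<beta>>0. \<exists>u v w. is_V_transform \<mu> \<alpha> \<beta> u \<and>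
      is_V_transform \<nu> \<alpha> \<beta> v \<and> is_V_transform \<rho> \<alpha> \<beta> w \<and> (\<forall>z\<in>truncated_cone \<alpha> \<beta>. w z = u z + v z))"
    using assms unfolding borel_prob_measures_def by blast
next
  fix \<sigma> assume a: "\<sigma> \<in> borel_prob_measures \<and> (\<exists>\<alpha>>0. \<exists>\<beta>>0. \<exists>u v w. is_V_transform \<mu> \<alpha> \<beta> u \<and>
      is_V_transform \<nu> \<alpha> \<beta> v \<and> is_V_transform \<sigma> \<alpha> \<beta> w \<and> (\<forall>z\<in>truncated_cone \<alpha> \<beta>. w z = u z + v z))"
  then obtain \<alpha>' \<beta>' u' v' w' where pos': "0 < \<alpha>'" "0 < \<beta>'"
      and V': "is_V_transform \<mu> \<alpha>' \<beta>' u'" "is_V_transform \<nu> \<alpha>' \<beta>' v'" "is_V_transform \<sigma> \<alpha>' \<beta>' w'"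
      and eq': "\<And>z. z \<in> truncated_cone \<alpha>' \<beta>' \<Longrightarrow> w' z = u' z + v' z"
    by blast
  define a b where "a = min \<alpha> \<alpha>'" and "b = max \<beta> \<beta>'"
  have a: "0 < a" "a \<le> \<alpha>" "a \<le> \<alpha>'" "\<beta> \<le> b" "\<beta>' \<le> b" and \<sigma>: "real_distribution \<sigma>"
    using pos pos' a by (auto simp: a_def b_def borel_prob_measures_def)
  show "\<sigma> = \<rho>"
  proof (rule V_transform_determines_measure[OF \<sigma> \<rho> a(1)])
    show "is_V_transform \<sigma> a b w'" "is_V_transform \<rho> a b w"
      using V(3) V'(3) a by (auto intro: is_V_transform_mono)
    fix z assume z: "z \<in> truncated_cone a b"
    have "u z = u' z"
      using V(1) V'(1) a z by (intro V_transform_unique[OF \<mu> a(1)]) (auto intro: is_V_transform_mono)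
    moreover have "v z = v' z"
      using V(2) V'(2) a z by (intro V_transform_unique[OF \<nu> a(1)]) (auto intro: is_V_transform_mono)
    moreover have "z \<in> truncated_cone \<alpha> \<beta>" "z \<in> truncated_cone \<alpha>' \<beta>'"
      using z truncated_cone_mono[OF a(2,4)] truncated_cone_mono[OF a(3,5)] by blast+
    ultimately show "w' z = w z"
      using eq[of z] eq'[of z] by simp
  qed
qed

text \<open>One measure with transform \<open>F \<circ> \<omega>\<close> yields all three claims.
  The last supplies a common \<open>u\<close> on every sufficiently high cone, so that different
  powers can be compared on one cone.\<close>

lemma free_power_props:
  assumes \<mu>: "real_distribution \<mu>" and t: "0 \<le> t"
  shows real_distribution_free_power: "real_distribution (free_power \<mu> (1 + t))"
    and F_transform_free_power: "0 < Im z \<Longrightarrow>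
      F_transform (free_power \<mu> (1 + t)) z = F_transform \<mu> (subordination (F_transform \<mu>) t z)"
    and V_transform_free_power: "\<exists>\<beta>0>0. \<forall>\<beta>\<ge>\<beta>0. \<exists>u. is_V_transform \<mu> 1 \<beta> u \<and>
      is_V_transform (free_power \<mu> (1 + t)) 1 \<beta> (\<lambda>z. of_real (1 + t) * u z)"
proof -
  let ?F = "F_transform \<mu>"
  note F = recip_cauchy_F_transform[OF \<mu>]
  obtain \<rho> where \<rho>: "real_distribution \<rho>"
      and F\<rho>: "\<And>z. 0 < Im z \<Longrightarrow> F_transform \<rho> z = ?F (subordination ?F t z)"
    using recip_cauchy_imp_F_transform[OF recip_cauchy_comp_subordination[OF F t]] by blast
  obtain \<beta>1 f where \<beta>1: "0 < \<beta>1" and f1: "is_F_right_inverse \<mu> 1 \<beta>1 f"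
    using ex_F_right_inverse[OF \<mu> zero_less_one] by blast
  \<comment> \<open>This accuracy keeps \<open>(1 + t) * (f z - z)\<close> below \<open>Im z\<close>
    in modulus, so \<open>g\<close> stays in the half-plane.\<close>
  have e: "0 < 1 / (1 + t)" using t by simp
  obtain b where b: "\<beta>1 \<le> b" "\<And>z. z \<in> truncated_cone 1 b \<Longrightarrow> cmod (f z - z) < 1 / (1 + t) * Im z"
    using F_right_inverse_near[OF f1 zero_less_one e] by blast
  have f: "is_F_right_inverse \<mu> 1 b f"
    by (rule is_F_right_inverse_mono[OF f1 order_refl b(1)])
  let ?\<Gamma> = "truncated_cone 1 b"
  define g where "g z = z + of_real (1 + t) * (f z - z)" for z
  have Img: "0 < Im (g z)" if z: "z \<in> ?\<Gamma>" for z
  proof -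
    have "cmod (of_real (1 + t) * (f z - z)) = (1 + t) * cmod (f z - z)"
      using t by (simp add: norm_mult del: of_real_add)
    also have "\<dots> < (1 + t) * (1 / (1 + t) * Im z)"
      using t by (intro mult_strict_left_mono b(2) z) auto
    also have "\<dots> = Im z" using t by simp
    finally have "\<bar>Im (of_real (1 + t) * (f z - z))\<bar> < Im z"
      by (rule le_less_trans[OF abs_Im_le_cmod])
    then show ?thesis unfolding g_def plus_complex.sel by linarith
  qed
  have "is_F_right_inverse \<rho> 1 b g"
    unfolding is_F_right_inverse_iff
  proof (intro conjI ballI allI impI)
    show "g holomorphic_on ?\<Gamma>"
      unfolding g_def[abs_def] using f by (intro holomorphic_intros) (simp add: is_F_right_inverse_iff)
    fix z assume z: "z \<in> ?\<Gamma>"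
    show "0 < Im (g z)" by (rule Img[OF z])
    have fz: "0 < Im (f z)" "?F (f z) = z"
      using f z by (auto simp: is_F_right_inverse_iff)
    have "burgers_map ?F t (f z) = g z"
      by (simp add: burgers_map_def g_def fz(2) algebra_simps)
    then have "subordination ?F t (g z) = f z"
      using Img[OF z] fz(1) by (intro subordination_eqI[OF F t])
    then show "F_transform \<rho> (g z) = z"
      using F\<rho>[OF Img[OF z]] fz(2) by simp
  next
    fix e :: real assume "0 < e"
    then have "0 < e / (1 + t)" using t by simp
    then obtain K where K: "\<And>z. z \<in> ?\<Gamma> \<Longrightarrow> K \<le> cmod z \<Longrightarrow> cmod (f z - z) < e / (1 + t) * cmod z"
      using f unfolding is_F_right_inverse_iff by blast
    have "cmod (g z - z) < e * cmod z" if z: "z \<in> ?\<Gamma>" "K \<le> cmod z" for z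
    proof -
      have "cmod (g z - z) = cmod (of_real (1 + t) * (f z - z))"
        by (simp only: g_def add_diff_cancel_left')
      also have "\<dots> = (1 + t) * cmod (f z - z)"
        using t by (simp add: norm_mult del: of_real_add)
      also have "\<dots> < (1 + t) * (e / (1 + t) * cmod z)"
        using t by (intro mult_strict_left_mono K z) auto
      also have "\<dots> = e * cmod z" using t by simp
      finally show ?thesis .
    qed
    then show "\<exists>b. \<forall>z\<in>?\<Gamma>. b \<le> cmod z \<longrightarrow> cmod (g z - z) < e * cmod z"
      by blast
  qed
  then have V: "is_V_transform \<rho> 1 b (\<lambda>z. of_real (1 + t) * (f z - z))"
    unfolding is_V_transform_def by (intro exI[of _ g]) (simp add: g_def)
  have U: "is_V_transform \<mu> 1 b (\<lambda>z. f z - z)"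
    using f unfolding is_V_transform_def by blast
  have b0: "0 < b" using b(1) \<beta>1 by simp
  have eq: "free_power \<mu> (1 + t) = \<rho>"
    by (rule free_power_eqI[OF \<mu> \<rho> zero_less_one b0 U V]) simp
  show "real_distribution (free_power \<mu> (1 + t))" unfolding eq by (rule \<rho>)
  show "0 < Im z \<Longrightarrow> F_transform (free_power \<mu> (1 + t)) z = ?F (subordination ?F t z)"
    unfolding eq by (rule F\<rho>)
  show "\<exists>\<beta>0>0. \<forall>\<beta>\<ge>\<beta>0. \<exists>u. is_V_transform \<mu> 1 \<beta> u \<and>
      is_V_transform (free_power \<mu> (1 + t)) 1 \<beta> (\<lambda>z. of_real (1 + t) * u z)"
    unfolding eq using b0 U V is_V_transform_mono[OF U order_refl] is_V_transform_mono[OF V order_refl] by blast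
qed

text \<open>\<open>Suc n\<close> copies correspond to the exponent \<open>1 + n\<close>. Each step
  adds one \<open>V\<close> of \<mu> on a cone shared by two consecutive powers.\<close>

lemma free_conv_nfold_eq_free_power:
  assumes \<mu>: "real_distribution \<mu>"
  shows "free_conv_nfold (Suc n) \<mu> = free_power \<mu> (1 + real n)"
proof (induction n)
  case 0
  obtain \<beta> u where \<beta>: "0 < \<beta>" "is_V_transform \<mu> 1 \<beta> u"
    using V_transform_free_power[OF \<mu> order_refl] by blast
  have "free_power \<mu> (1 + real 0) = \<mu>"
    by (rule free_power_eqI[OF \<mu> \<mu> zero_less_one \<beta>(1) \<beta>(2) \<beta>(2)]) simp
  then show ?case by (simp add: free_conv_nfold_def)
next
  case (Suc n)
  have n: "0 \<le> real n" "0 \<le> real (Suc n)" by simp_all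
  obtain \<beta>1 where \<beta>1: "0 < \<beta>1" "\<And>\<beta>. \<beta>1 \<le> \<beta> \<Longrightarrow> \<exists>u. is_V_transform \<mu> 1 \<beta> u \<and>
      is_V_transform (free_power \<mu> (1 + real n)) 1 \<beta> (\<lambda>z. of_real (1 + real n) * u z)"
    using V_transform_free_power[OF \<mu> n(1)] by blast
  obtain \<beta>2 where \<beta>2: "0 < \<beta>2" "\<And>\<beta>. \<beta>2 \<le> \<beta> \<Longrightarrow> \<exists>u. is_V_transform \<mu> 1 \<beta> u \<and>
      is_V_transform (free_power \<mu> (1 + real (Suc n))) 1 \<beta> (\<lambda>z. of_real (1 + real (Suc n)) * u z)"
    using V_transform_free_power[OF \<mu> n(2)] by blast
  define \<beta> where "\<beta> = max \<beta>1 \<beta>2"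
  have \<beta>: "0 < \<beta>" "\<beta>1 \<le> \<beta>" "\<beta>2 \<le> \<beta>" using \<beta>1(1) by (auto simp: \<beta>_def)
  obtain u where u: "is_V_transform \<mu> 1 \<beta> u"
      "is_V_transform (free_power \<mu> (1 + real n)) 1 \<beta> (\<lambda>z. of_real (1 + real n) * u z)"
    using \<beta>1(2)[OF \<beta>(2)] by blast
  obtain v where v: "is_V_transform \<mu> 1 \<beta> v"
      "is_V_transform (free_power \<mu> (1 + real (Suc n))) 1 \<beta> (\<lambda>z. of_real (1 + real (Suc n)) * v z)"
    using \<beta>2(2)[OF \<beta>(3)] by blast
  have "free_conv \<mu> (free_power \<mu> (1 + real n)) = free_power \<mu> (1 + real (Suc n))"
  proof (rule free_conv_eqI[OF \<mu> real_distribution_free_power[OF \<mu> n(1)]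
        real_distribution_free_power[OF \<mu> n(2)] zero_less_one \<beta>(1) u v(2)])
    fix z assume "z \<in> truncated_cone 1 \<beta>"
    then have "u z = v z" by (rule V_transform_unique[OF \<mu> zero_less_one u(1) v(1)])
    then show "of_real (1 + real (Suc n)) * v z = u z + of_real (1 + real n) * u z"
      by (simp add: algebra_simps)
  qed
  with Suc show ?case by (simp add: free_conv_nfold_def)
qed

section \<open>Free powers in the range of \<open>BB\<close>\<close>

text \<open>The formula is parametrised by the preimage \<open>w\<close>, so that several measures
  can be evaluated along the same \<open>w\<close> without composing subordination
  functions.\<close>

lemma BB_props:
  assumes \<mu>: "real_distribution \<mu>" and t: "0 \<le> t"
  shows real_distribution_BB: "real_distribution (BB t \<mu>)"
    and F_transform_BB: "0 < Im w \<Longrightarrow> 0 < Im (burgers_map (F_transform \<mu>) t w) \<Longrightarrow>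
      F_transform (BB t \<mu>) (burgers_map (F_transform \<mu>) t w)
        = burgers_map (F_transform \<mu>) t w - (w - F_transform \<mu> w)"
proof -
  note \<rho> = free_power_props[OF \<mu> t]
  have s: "0 \<le> 1 / (1 + t)" using t by simp
  show "real_distribution (BB t \<mu>)"
    unfolding BB_def by (rule boolean_power_props(1)[OF \<rho>(1) s])
  let ?F = "F_transform \<mu>"
  assume w: "0 < Im w" and z: "0 < Im (burgers_map ?F t w)"
  have "subordination ?F t (burgers_map ?F t w) = w"
    by (rule subordination_eqI[OF recip_cauchy_F_transform[OF \<mu>] t w refl z])
  then have eq: "F_transform (BB t \<mu>) (burgers_map ?F t w)
      = of_real (1 / (1 + t)) * ?F w + (1 - of_real (1 / (1 + t))) * burgers_map ?F t w"
    using boolean_power_props(2)[OF \<rho>(1) s z] \<rho>(2)[OF z] by (simp add: BB_def)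
  \<comment> \<open>With \<open>z\<close> the image of \<open>w\<close>,
    \<open>z - F w = (1 + t) * (w - F w)\<close>; the Boolean exponent \<open>1 / (1 + t)\<close>
    cancels the factor.\<close>
  have "(1 + complex_of_real t) \<noteq> 0"
    using t by (auto simp: complex_eq_iff)
  then show "F_transform (BB t \<mu>) (burgers_map ?F t w) = burgers_map ?F t w - (w - ?F w)"
    unfolding eq unfolding burgers_map_def by (simp add: divide_simps) (simp add: algebra_simps)
qed

text \<open>All measures are followed along one \<open>w\<close>. Time
  \<open>s = t - m / (1 + m)\<close> leads to \<open>x = w + s * E\<close>, the Boolean power
  reduces \<open>E\<close> to \<open>E / (1 + m)\<close>, and the free power moves \<open>x\<close>
  by \<open>m * E / (1 + m)\<close>, arriving at \<open>w + t * E\<close>. This exhibits a free root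
  of \<open>BB t \<nu>\<close>.\<close>

lemma free_power_BB_boolean_power:
  assumes \<nu>: "real_distribution \<nu>" and m: "0 \<le> m" and t: "m / (1 + m) \<le> t"
  shows "free_power (boolean_power (BB (t - m / (1 + m)) \<nu>) (1 / (1 + m))) (1 + m) = BB t \<nu>"
proof -
  define s where "s = t - m / (1 + m)"
  have m1: "0 \<le> m / (1 + m)" using m by simp
  have s: "0 \<le> s" "s \<le> t" using t m1 by (simp_all add: s_def)
  have t0: "0 \<le> t" using s by linarith
  have r: "0 \<le> 1 / (1 + m)" using m by simp
  note \<rho> = real_distribution_BB[OF \<nu> s(1)]
  let ?\<mu> = "boolean_power (BB s \<nu>) (1 / (1 + m))"
  note \<mu> = boolean_power_props[OF \<rho> r]
  let ?F = "F_transform \<nu>"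
  note F = recip_cauchy_F_transform[OF \<nu>]
  have "free_power ?\<mu> (1 + m) = BB t \<nu>"
  proof (rule F_transform_inject[OF real_distribution_free_power[OF \<mu>(1) m] real_distribution_BB[OF \<nu> t0]])
    fix z :: complex assume z: "0 < Im z"
    define w where "w = subordination ?F t z"
    have w: "0 < Im w" and wz: "burgers_map ?F t w = z"
      using subordination_props[OF F t0 z] by (simp_all add: w_def)
    define E where "E = w - ?F w"
    define x where "x = burgers_map ?F s w"
    have xE: "x = w + of_real s * E" and zE: "z = w + of_real t * E"
      using wz by (simp_all add: x_def E_def burgers_map_def)
    \<comment> \<open>Going back from time \<open>t\<close> to \<open>s\<close> can only raise the
      point, so \<open>x\<close> is in the half-plane because \<open>z\<close> is.\<close>
    have "Im E \<le> 0" using recip_cauchy_Im_ge[OF F w] by (simp add: E_def)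
    then have "t * Im E \<le> s * Im E" using s(2) by (rule mult_right_mono_neg[rotated])
    then have x: "0 < Im x" using z by (simp add: xE zE)
    have "F_transform (BB s \<nu>) x = x - E"
      using F_transform_BB[OF \<nu> s(1) w] x by (simp add: x_def E_def)
    then have F\<mu>: "F_transform ?\<mu> x = x - of_real (1 / (1 + m)) * E"
    proof -
      have "c * (x - E) + (1 - c) * x = x - c * E" for c :: complex
        by (simp add: algebra_simps)
      with \<open>F_transform (BB s \<nu>) x = x - E\<close> show ?thesis
        using \<mu>(2)[OF x] by (simp only:)
    qed
    have "burgers_map (F_transform ?\<mu>) m x = x + of_real m * (of_real (1 / (1 + m)) * E)"
      unfolding burgers_map_def F\<mu> by simp
    also have "\<dots> = w + of_real (s + m / (1 + m)) * E"
      by (simp add: xE algebra_simps)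
    also have "\<dots> = z" by (simp add: s_def zE)
    finally have "subordination (F_transform ?\<mu>) m z = x"
      using x z by (intro subordination_eqI[OF recip_cauchy_F_transform[OF \<mu>(1)] m])
    then have "F_transform (free_power ?\<mu> (1 + m)) z = x - of_real (1 / (1 + m)) * E"
      using F_transform_free_power[OF \<mu>(1) m z] F\<mu> by simp
    also have "\<dots> = z - E"
    proof -
      have "s - 1 / (1 + m) = t - 1"
        using m by (simp add: s_def divide_simps) (simp add: algebra_simps)
      then have "complex_of_real s - of_real (1 / (1 + m)) = of_real t - 1"
        by (metis of_real_diff of_real_1)
      then have "(complex_of_real s - of_real (1 / (1 + m))) * E = (of_real t - 1) * E"
        by simp
      then show ?thesis by (simp add: xE zE left_diff_distrib)
    qed
    also have "z - E = F_transform (BB t \<nu>) z"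
      using F_transform_BB[OF \<nu> t0 w] z by (simp add: wz E_def)
    finally show "F_transform (free_power ?\<mu> (1 + m)) z = F_transform (BB t \<nu>) z" .
  qed
  then show ?thesis by (simp add: s_def)
qed

text \<open>The Boolean power multiplies \<open>E\<close> by \<open>1 + m\<close>, so time
  \<open>m / (1 + m)\<close> produces the displacement \<open>m * E\<close> of the free power, from
  the same \<open>w\<close>.\<close>

lemma BB_boolean_power_eq_free_power:
  assumes \<mu>: "real_distribution \<mu>" and m: "0 \<le> m"
  shows "BB (m / (1 + m)) (boolean_power \<mu> (1 + m)) = free_power \<mu> (1 + m)"
proof -
  let ?\<nu> = "boolean_power \<mu> (1 + m)"
  have t: "0 \<le> m / (1 + m)" and r: "0 \<le> 1 + m" and r0: "1 + m \<noteq> 0" using m by simp_all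
  note \<nu> = boolean_power_props[OF \<mu> r]
  let ?F = "F_transform \<mu>"
  note F = recip_cauchy_F_transform[OF \<mu>]
  show ?thesis
  proof (rule F_transform_inject[OF real_distribution_BB[OF \<nu>(1) t] real_distribution_free_power[OF \<mu> m]])
    fix z :: complex assume z: "0 < Im z"
    define w where "w = subordination ?F m z"
    have w: "0 < Im w" and wz: "burgers_map ?F m w = z"
      using subordination_props[OF F m z] by (simp_all add: w_def)
    have E\<nu>: "w - F_transform ?\<nu> w = of_real (1 + m) * (w - ?F w)"
      using \<nu>(2)[OF w] by (simp add: algebra_simps)
    have "of_real (m / (1 + m)) * (of_real (1 + m) * (w - ?F w)) = of_real m * (w - ?F w)"
      using r0 by (simp only: mult.assoc[symmetric] of_real_mult[symmetric] times_divide_eq_left) simp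
    then have "burgers_map (F_transform ?\<nu>) (m / (1 + m)) w = z"
      using wz by (simp only: burgers_map_def E\<nu>)
    then have "F_transform (BB (m / (1 + m)) ?\<nu>) z = z - of_real (1 + m) * (w - ?F w)"
      using F_transform_BB[OF \<nu>(1) t w] z E\<nu> by simp
    also have "\<dots> = ?F w"
      using wz[symmetric] by (simp add: burgers_map_def algebra_simps)
    also have "\<dots> = F_transform (free_power \<mu> (1 + m)) z"
      using F_transform_free_power[OF \<mu> m z] by (simp add: w_def)
    finally show "F_transform (BB (m / (1 + m)) ?\<nu>) z = F_transform (free_power \<mu> (1 + m)) z" .
  qed
qed

theorem proposition5p4:
  fixes \<mu> :: "real measure"
  assumes "\<mu> \<in> borel_prob_measures"
  shows "free_infinitely_divisible \<mu> \<longleftrightarrow> free_divisibility_indicator \<mu> \<ge> 1"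
proof
  assume inf: "free_infinitely_divisible \<mu>"
  \<comment> \<open>A free root of order \<open>Suc m\<close> places \<mu> in the range of
    \<open>BB\<close> at time \<open>m / (1 + m)\<close>.\<close>
  have le: "ennreal (real m / (1 + real m)) \<le> free_divisibility_indicator \<mu>" for m
  proof -
    obtain \<sigma> where "\<sigma> \<in> borel_prob_measures" and \<sigma>\<mu>: "free_conv_nfold (Suc m) \<sigma> = \<mu>"
      using inf unfolding free_infinitely_divisible_def by (metis le_add1 plus_1_eq_Suc)
    then have \<sigma>: "real_distribution \<sigma>" by (simp add: borel_prob_measures_def)
    have "\<mu> = BB (real m / (1 + real m)) (boolean_power \<sigma> (1 + real m))"
      using free_conv_nfold_eq_free_power[OF \<sigma>, of m] BB_boolean_power_eq_free_power[OF \<sigma>, of "real m"] \<sigma>\<mu>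
      by simp
    moreover have "boolean_power \<sigma> (1 + real m) \<in> borel_prob_measures"
      using boolean_power_props(1)[OF \<sigma>, of "1 + real m"] by (simp add: borel_prob_measures_def)
    ultimately have "\<mu> \<in> BB (real m / (1 + real m)) ` borel_prob_measures"
      by (rule image_eqI)
    then show ?thesis
      unfolding free_divisibility_indicator_def by (intro Sup_upper) auto
  qed
  have "(\<lambda>m. real m / (1 + real m)) \<longlonglongrightarrow> 1"
    by real_asymp
  then have "(\<lambda>m. ennreal (real m / (1 + real m))) \<longlonglongrightarrow> ennreal 1"
    by (rule tendsto_ennrealI)
  from LIMSEQ_le_const2[OF this] show "1 \<le> free_divisibility_indicator \<mu>"
    using le by auto
next
  assume ge: "1 \<le> free_divisibility_indicator \<mu>"
  show "free_infinitely_divisible \<mu>"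
    unfolding free_infinitely_divisible_def
  proof (intro allI impI)
    fix n :: nat assume "1 \<le> n"
    then obtain m where n: "n = Suc m" by (cases n) auto
    have m: "0 \<le> real m" by simp
    \<comment> \<open>Strictness below 1 lets an actual member \<open>t\<close> of the set be chosen
      beyond \<open>m / (1 + m)\<close>, as \<open>free_power_BB_boolean_power\<close>
      requires.\<close>
    have "ennreal (real m / (1 + real m)) < ennreal 1"
      by (simp add: ennreal_less_iff)
    also have "\<dots> \<le> free_divisibility_indicator \<mu>"
      using ge by simp
    finally obtain t where t: "0 \<le> t" "\<mu> \<in> BB t ` borel_prob_measures"
        and "ennreal (real m / (1 + real m)) < ennreal t"
      unfolding free_divisibility_indicator_def less_Sup_iff by blast
    then have tm: "real m / (1 + real m) \<le> t"
      by (simp add: ennreal_less_iff)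
    obtain \<nu> where \<nu>: "real_distribution \<nu>" "\<mu> = BB t \<nu>"
      using t(2) by (auto simp: borel_prob_measures_def)
    let ?\<sigma> = "boolean_power (BB (t - real m / (1 + real m)) \<nu>) (1 / (1 + real m))"
    have \<sigma>: "real_distribution ?\<sigma>"
      using tm by (intro boolean_power_props(1) real_distribution_BB \<nu>(1)) simp_all
    have "free_conv_nfold n ?\<sigma> = \<mu>"
      using free_conv_nfold_eq_free_power[OF \<sigma>, of m] free_power_BB_boolean_power[OF \<nu>(1) m tm] \<nu>(2) n
      by simp
    then show "\<exists>\<sigma>\<in>borel_prob_measures. free_conv_nfold n \<sigma> = \<mu>"
      using \<sigma> by (auto simp: borel_prob_measures_def)
  qed
qed

end
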